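(* Let $N\geq 5$ be an integer, $\alpha>2-N$ and $\frac{N-4}{N-2}\alpha-4\leq\beta\leq\alpha-2$. For each $u\in\mathcal{D}^{2,2}_{\alpha,\beta}(\mathbb{R}^N\setminus\{0\})$, write $u(x)=|x|^{\eta}v(x)$ with $\eta=2+\beta-\alpha$. Then $$\int_{\mathbb{R}^N}|x|^{\xi}|u|^{\bar{2}^{**}_{\alpha,\beta}}\,dx=\int_{\mathbb{R}^N}|x|^{\bar\beta}|v|^{2^{**}_{\alpha,\bar\beta}}\,dx,$$ $$\int_{\mathbb{R}^N}|x|^{-\beta}|\mathrm{div}(|x|^{\alpha}\nabla u)|^2\,dx=\int_{\mathbb{R}^N}|x|^{-\bar\beta}|\mathrm{div}(|x|^{\alpha}\nabla v)|^2\,dx,$$ where $\bar{2}^{**}_{\alpha,\beta}=\frac{2(N+\xi)}{N+2\alpha-\beta-4}$ with $\xi=\frac{(N+2\alpha-\beta-4)^2}{N+\beta}-N$, $\bar\beta=2\alpha-\beta-4$, and $2^{**}_{\alpha,\bar\beta}=\frac{2(N+\bar\beta)}{N-4+2\alpha-\bar\beta}$.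
   Context: $\mathcal{D}^{2,2}_{\alpha,\beta}(\mathbb{R}^N\setminus\{0\})$ denotes the completion of $C^\infty_0(\mathbb{R}^N\setminus\{0\})$ with respect to the norm $\left(\int_{\mathbb{R}^N}|x|^{-\beta}|\mathrm{div}(|x|^{\alpha}\nabla u)|^2\,dx\right)^{1/2}$. *)

theory Defs
  imports "HOL-Analysis.Analysis"
begin

definition partial_deriv :: "'n \<Rightarrow> (real^'n::finite \<Rightarrow> real) \<Rightarrow> real^'n \<Rightarrow> real" where
  "partial_deriv i f x = frechet_derivative f (at x) (axis i 1)"

definition grad :: "(real^'n::finite \<Rightarrow> real) \<Rightarrow> real^'n \<Rightarrow> real^'n" where
  "grad f x = (\<chi> i. partial_deriv i f x)"

definition divergence :: "(real^'n::finite \<Rightarrow> real^'n) \<Rightarrow> real^'n \<Rightarrow> real" where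
  "divergence F x = (\<Sum>i\<in>UNIV. partial_deriv i (\<lambda>y. F y $ i) x)"

text \<open>Classical \<open>div(|x|\<^sup>\<alpha> \<nabla>f)\<close>. It is only used for test functions, which vanish near the
  origin, so the singularity of the weight is harmless.\<close>

definition wdiv :: "real \<Rightarrow> (real^'n::finite \<Rightarrow> real) \<Rightarrow> real^'n \<Rightarrow> real" where
  "wdiv \<alpha> f = divergence (\<lambda>x. norm x powr \<alpha> *\<^sub>R grad f x)"

primrec Ck :: "nat \<Rightarrow> (real^'n::finite \<Rightarrow> real) \<Rightarrow> bool" where
  "Ck 0 f \<longleftrightarrow> continuous_on UNIV f"
| "Ck (Suc k) f \<longleftrightarrow> f differentiable_on UNIV \<and> (\<forall>i. Ck k (partial_deriv i f))"

text \<open>\<open>C\<^sub>0\<^sup>\<infinity>(\<real>\<^sup>N - {0})\<close>, each function being extended by \<open>0\<close> to the origin.\<close>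

definition test_function :: "(real^'n::finite \<Rightarrow> real) \<Rightarrow> bool" where
  "test_function f \<longleftrightarrow> (\<forall>k. Ck k f) \<and>
     compact (closure (support_on UNIV f)) \<and> 0 \<notin> closure (support_on UNIV f)"

text \<open>\<open>L\<^sup>1\<^sub>l\<^sub>o\<^sub>c(\<real>\<^sup>N - {0})\<close>\<close>

definition loc_integrable :: "(real^'n::finite \<Rightarrow> real) \<Rightarrow> bool" where
  "loc_integrable f \<longleftrightarrow> (\<forall>K. compact K \<and> 0 \<notin> K \<longrightarrow> f absolutely_integrable_on K)"

text \<open>\<open>f = div(|x|\<^sup>\<alpha> \<nabla>u)\<close> in the sense of distributions on \<open>\<real>\<^sup>N - {0}\<close>, where \<open>|x|\<^sup>\<alpha>\<close> is smooth:
  \<open>\<langle>div(|x|\<^sup>\<alpha> \<nabla>u), \<psi>\<rangle> = - \<langle>\<nabla>u, |x|\<^sup>\<alpha> \<nabla>\<psi>\<rangle> = \<langle>u, div(|x|\<^sup>\<alpha> \<nabla>\<psi>)\<rangle>\<close>.\<close>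

definition has_weak_wdiv ::
  "real \<Rightarrow> (real^'n::finite \<Rightarrow> real) \<Rightarrow> (real^'n \<Rightarrow> real) \<Rightarrow> bool" where
  "has_weak_wdiv \<alpha> u f \<longleftrightarrow> loc_integrable u \<and> loc_integrable f \<and>
     (\<forall>\<psi>. test_function \<psi> \<longrightarrow>
        (LINT x|lebesgue. f x * \<psi> x) = (LINT x|lebesgue. u x * wdiv \<alpha> \<psi> x))"

text \<open>A representative of the distribution \<open>div(|x|\<^sup>\<alpha> \<nabla>u)\<close>, unique up to null sets when it exists.\<close>

definition weak_wdiv :: "real \<Rightarrow> (real^'n::finite \<Rightarrow> real) \<Rightarrow> real^'n \<Rightarrow> real" where
  "weak_wdiv \<alpha> u = (SOME f. has_weak_wdiv \<alpha> u f)"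

definition D22_norm :: "real \<Rightarrow> real \<Rightarrow> (real^'n::finite \<Rightarrow> real) \<Rightarrow> real" where
  "D22_norm \<alpha> \<beta> f = sqrt (LINT x|lebesgue. norm x powr (- \<beta>) * \<bar>wdiv \<alpha> f x\<bar>\<^sup>2)"

text \<open>The completion of the test functions under \<open>D22_norm \<alpha> \<beta>\<close>, realised as a space of functions
  (each class modulo null sets being represented by all its members): \<open>u\<close> belongs to it iff it is
  the \<open>L\<^sup>1\<^sub>l\<^sub>o\<^sub>c(\<real>\<^sup>N - {0})\<close> limit of a norm-Cauchy sequence of test functions. If
  \<open>N + 2\<alpha> - \<beta> - 4 > 0\<close>, \<open>N + \<beta> > 0\<close> and \<open>\<beta> \<le> \<alpha> - 2\<close>, this is the abstract completion: by the
  weighted Rellich inequality the norm controls the norm of \<open>L\<^sup>2(|x|\<^bsup>2\<alpha>-\<beta>-4\<^esup> dx)\<close>, so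
  norm-Cauchy sequences converge in \<open>L\<^sup>1\<^sub>l\<^sub>o\<^sub>c\<close>, and two of them have the same limit iff
  their difference tends to \<open>0\<close> in norm.\<close>

definition D22 :: "real \<Rightarrow> real \<Rightarrow> (real^'n::finite \<Rightarrow> real) set" where
  "D22 \<alpha> \<beta> = {u. loc_integrable u \<and> (\<exists>\<phi> :: nat \<Rightarrow> real^'n \<Rightarrow> real.
     (\<forall>n. test_function (\<phi> n)) \<and>
     (\<forall>e>0. \<exists>M. \<forall>m\<ge>M. \<forall>n\<ge>M. D22_norm \<alpha> \<beta> (\<lambda>x. \<phi> m x - \<phi> n x) < e) \<and>
     (\<forall>K. compact K \<and> 0 \<notin> K \<longrightarrow>
        (\<lambda>n. LINT x:K|lebesgue. \<bar>\<phi> n x - u x\<bar>) \<longlonglongrightarrow> 0))}"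

end

theory Submission
  imports Defs
begin

text \<open>Put \<open>A = N + 2\<alpha> - \<beta> - 4\<close>, \<open>B = N + \<beta>\<close> and \<open>r = |x|\<close>. The first identity is pointwise, because
  \<open>p = q = 2A / B\<close> and \<open>\<xi> + \<eta> p = \<beta>'\<close>. For a test function \<open>u\<close> write \<open>u = r\<^bsup>-A/2\<^esup> w\<close>, so that
  \<open>v = r\<^bsup>-B/2\<^esup> w\<close>. With \<open>E = x \<bullet> \<nabla>\<close> and \<open>P w = r\<^sup>2 \<Delta>w - (N - 2) E w - (AB/4) w\<close> the two energy
  densities are \<open>r\<^bsup>-N\<^esup> (P w + \<eta> E w)\<^sup>2\<close> and \<open>r\<^bsup>-N\<^esup> (P w - \<eta> E w)\<^sup>2\<close>, and the cross term
  \<open>r\<^bsup>-N\<^esup> E w P w\<close> is a divergence (in the variable \<open>log r\<close> it is a total derivative). For general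
  \<open>u\<close> approximate by test functions \<open>\<phi>\<^sub>n\<close>: then \<open>r\<^bsup>-\<eta>\<^esup> \<phi>\<^sub>n\<close> is a Cauchy sequence for the weight
  \<open>\<beta>'\<close> tending to \<open>v\<close>, and the weak operators are the weighted \<open>L\<^sup>2\<close> limits of the classical ones.\<close>

section \<open>Derivatives of functions supported in an annulus\<close>

text \<open>Dilations preserve the measure \<open>r^(-N) dx\<close>; in \<open>t = log r\<close> it
  is \<open>dt\<close> times the surface measure of the unit sphere. There \<open>E\<close> becomes
  \<open>d/dt\<close>, and \<open>r^2 Delta\<close> becomes \<open>d^2/dt^2 + (N - 2) d/dt\<close>
  plus the spherical Laplacian. Hence \<open>P\<close> has no first-order term: it is symmetric, has
  coefficients independent of \<open>t\<close>, and commutes with the skew operator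
  \<open>E\<close>, which forces the pairing of \<open>E w\<close> with \<open>P w\<close> to
  vanish. The halves \<open>A/2\<close> and \<open>B/2\<close> are the exponents that bring both
  energies to this measure; since \<open>B - A = 2 \<eta>\<close> one \<open>w\<close> serves both,
  and the product \<open>A B\<close> makes their zeroth-order terms agree.

  The passage to general \<open>u\<close> is shaped by \<open>weak_wdiv\<close> being a chosen
  representative. Nothing can be said about it before a weak operator is known to exist, which comes
  from completeness of L2, and to be unique up to null sets, which comes from the fundamental lemma
  of the calculus of variations and hence from smooth cutoffs.\<close>

lemma partial_deriv_eqI:
  assumes "(f has_derivative f') (at x)"
  shows "partial_deriv i f x = f' (axis i 1)"
  using frechet_derivative_at[OF assms] by (simp add: partial_deriv_def)

lemma has_derivative_frechet:
  assumes "f differentiable at x"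
  shows "(f has_derivative frechet_derivative f (at x)) (at x)"
  using assms frechet_derivative_works by blast

lemma partial_deriv_add:
  assumes "f differentiable at x" "g differentiable at x"
  shows "partial_deriv i (\<lambda>x. f x + g x) x = partial_deriv i f x + partial_deriv i g x"
  by (subst partial_deriv_eqI[OF has_derivative_add[OF assms[THEN has_derivative_frechet]]])
    (simp add: partial_deriv_def)

lemma partial_deriv_mult:
  assumes "f differentiable at x" "g differentiable at x"
  shows "partial_deriv i (\<lambda>x. f x * g x) x = f x * partial_deriv i g x + partial_deriv i f x * g x"
  by (subst partial_deriv_eqI[OF has_derivative_mult[OF assms[THEN has_derivative_frechet]]])
    (simp add: partial_deriv_def)

lemma partial_deriv_cmult:
  assumes "f differentiable at x"
  shows "partial_deriv i (\<lambda>x. c * f x) x = c * partial_deriv i f x"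
  by (subst partial_deriv_eqI[OF has_derivative_mult_right[OF has_derivative_frechet[OF assms]]])
    (simp add: partial_deriv_def)

lemma partial_deriv_sum:
  assumes "\<And>j. j \<in> J \<Longrightarrow> f j differentiable at x"
  shows "partial_deriv i (\<lambda>x. \<Sum>j\<in>J. f j x) x = (\<Sum>j\<in>J. partial_deriv i (f j) x)"
  by (subst partial_deriv_eqI[OF has_derivative_sum[OF has_derivative_frechet[OF assms]]])
    (simp_all add: partial_deriv_def)

lemma partial_deriv_const: "partial_deriv i (\<lambda>x. c) x = 0"
  by (simp add: partial_deriv_eqI[OF has_derivative_const])

lemma has_derivative_component: "((\<lambda>x::real^'n::finite. x $ j) has_derivative (\<lambda>h. h $ j)) (at x)"
  by (intro bounded_linear_imp_has_derivative bounded_linear_vec_nth)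

lemma partial_deriv_component: "partial_deriv i (\<lambda>x. x $ j) x = (if i = j then 1 else 0)"
  by (simp add: partial_deriv_eqI[OF has_derivative_component] axis_def)

lemma has_derivative_cong_nhds:
  assumes "eventually (\<lambda>y. f y = g y) (nhds x)"
  shows "(f has_derivative D) (at x) \<longleftrightarrow> (g has_derivative D) (at x)"
  using assms unfolding eventually_nhds
  by (metis has_derivative_transform_within_open)

lemma partial_deriv_cong_nhds:
  assumes "eventually (\<lambda>y. f y = g y) (nhds x)"
  shows "partial_deriv i f x = partial_deriv i g x"
proof -
  have "(f has_derivative D) (at x) \<longleftrightarrow> (g has_derivative D) (at x)" for D
    using assms by (rule has_derivative_cong_nhds)
  then show ?thesis unfolding partial_deriv_def frechet_derivative_def by simp
qed

section \<open>Closure properties of the classes C^k\<close>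

lemma Ck_differentiable: "Ck (Suc k) f \<Longrightarrow> f differentiable at x"
  by (simp add: differentiable_on_def)

lemma Ck_partial_deriv: "Ck (Suc k) f \<Longrightarrow> Ck k (partial_deriv i f)"
  by simp

lemma Ck_SucI:
  assumes "\<And>x. f differentiable at x" "\<And>i. Ck k (partial_deriv i f)"
  shows "Ck (Suc k) f"
  using assms by (simp add: differentiable_on_def)

text \<open>Continuity is demanded only at level 0, so at the bottom of the recursion it has to be
  recovered from differentiability.\<close>

lemma Ck_SucD: "Ck (Suc k) f \<Longrightarrow> Ck k f"
proof (induction k arbitrary: f)
  case 0
  then show ?case by (simp add: differentiable_imp_continuous_on)
next
  case (Suc k)
  then show ?case by (metis Ck.simps(2))
qed

lemma Ck_mono: "Ck m f \<Longrightarrow> k \<le> m \<Longrightarrow> Ck k f"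
  by (induction m) (use Ck_SucD le_Suc_eq in blast)+

lemma Ck_continuous: "Ck k f \<Longrightarrow> continuous_on UNIV f"
  using Ck_mono[of k f 0] by simp

lemma Ck_const: "Ck k (\<lambda>x. c)"
proof (induction k arbitrary: c)
  case (Suc k)
  then show ?case
    by (intro Ck_SucI) (simp_all add: partial_deriv_const[abs_def])
qed simp

lemma Ck_component: "Ck k (\<lambda>x. x $ j)"
proof (cases k)
  case (Suc k)
  show ?thesis unfolding Suc
    by (intro Ck_SucI)
      (auto simp: partial_deriv_component[abs_def] Ck_const differentiable_def intro: has_derivative_component)
qed (simp add: continuous_on_component)

lemma Ck_add: "Ck k f \<Longrightarrow> Ck k g \<Longrightarrow> Ck k (\<lambda>x. f x + g x)"
proof (induction k arbitrary: f g)
  case 0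
  then show ?case by (simp add: continuous_on_add)
next
  case (Suc k)
  note d = Suc.prems[THEN Ck_differentiable]
  show ?case
  proof (rule Ck_SucI)
    show "(\<lambda>x. f x + g x) differentiable at x" for x using d by simp
    have "partial_deriv i (\<lambda>x. f x + g x) = (\<lambda>x. partial_deriv i f x + partial_deriv i g x)" for i
      using d by (auto simp: partial_deriv_add)
    then show "Ck k (partial_deriv i (\<lambda>x. f x + g x))" for i
      using Suc by simp
  qed
qed

lemma Ck_mult: "Ck k f \<Longrightarrow> Ck k g \<Longrightarrow> Ck k (\<lambda>x. f x * g x)"
proof (induction k arbitrary: f g)
  case 0
  then show ?case by (simp add: continuous_on_mult)
next
  case (Suc k)
  note d = Suc.prems[THEN Ck_differentiable]
  show ?case
  proof (rule Ck_SucI)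
    show "(\<lambda>x. f x * g x) differentiable at x" for x using d by simp
    have "partial_deriv i (\<lambda>x. f x * g x) = (\<lambda>x. f x * partial_deriv i g x + partial_deriv i f x * g x)" for i
      using d by (auto simp: partial_deriv_mult)
    then show "Ck k (partial_deriv i (\<lambda>x. f x * g x))" for i
      using Suc Suc.prems[THEN Ck_SucD] by (auto intro!: Ck_add Suc.IH)
  qed
qed

lemma Ck_prod: "(\<And>j. j \<in> J \<Longrightarrow> Ck k (f j)) \<Longrightarrow> Ck k (\<lambda>x. \<Prod>j\<in>J. f j x)"
  by (induction J rule: infinite_finite_induct) (auto intro: Ck_const Ck_mult)

text \<open>The support is kept away from the origin and bounded, so that every power of \<open>|x|\<close> is a harmless
  smooth factor; at \<open>0\<close>, where \<open>0 powr s = 0\<close>, both sides of the formulas below vanish.\<close>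

definition annular :: "(real^'n::finite \<Rightarrow> real) \<Rightarrow> bool" where
  "annular f \<longleftrightarrow> (\<exists>d>0. \<exists>R. \<forall>x. norm x < d \<or> R < norm x \<longrightarrow> f x = 0)"

text \<open>The order \<open>k\<close> stays finite so that each lemma can count derivatives:
  \<open>partial_deriv\<close> costs one, \<open>wdiv\<close> costs two, a power of
  \<open>norm x\<close> costs none.\<close>

definition Ck0 :: "nat \<Rightarrow> (real^'n::finite \<Rightarrow> real) \<Rightarrow> bool" where
  "Ck0 k f \<longleftrightarrow> Ck k f \<and> annular f"

lemma annularD:
  assumes "annular f"
  obtains d R where "d > 0" "R > 0" "\<And>x. norm x < d \<Longrightarrow> f x = 0" "\<And>x. R < norm x \<Longrightarrow> f x = 0"
proof -
  obtain d R where "d > 0" "\<And>x. norm x < d \<or> R < norm x \<Longrightarrow> f x = 0"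
    using assms unfolding annular_def by blast
  then show ?thesis by (intro that[of d "max R 1"]) auto
qed

lemma annular_weaken:
  assumes "annular f" "\<And>x. f x = 0 \<Longrightarrow> g x = 0"
  shows "annular g"
  using assms unfolding annular_def by metis

lemma annular_add:
  assumes "annular f" "annular g"
  shows "annular (\<lambda>x. f x + g x)"
proof -
  obtain d R where "d > 0" "\<And>x. norm x < d \<Longrightarrow> f x = 0" "\<And>x. R < norm x \<Longrightarrow> f x = 0"
    using annularD[OF assms(1)] by metis
  moreover obtain d' R' where "d' > 0" "\<And>x. norm x < d' \<Longrightarrow> g x = 0" "\<And>x. R' < norm x \<Longrightarrow> g x = 0"
    using annularD[OF assms(2)] by metis
  ultimately show ?thesis
    unfolding annular_def by (intro exI[of _ "min d d'"] conjI exI[of _ "max R R'"]) auto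
qed

text \<open>Both regions on which \<open>f\<close> vanishes are open, so \<open>f\<close> is locally
  zero there and the same \<open>d\<close> and \<open>R\<close> serve for the derivative.\<close>

lemma annular_partial_deriv:
  assumes "annular f"
  shows "annular (partial_deriv i f)"
proof -
  obtain d R where dR: "d > 0" "\<And>x. norm x < d \<Longrightarrow> f x = 0" "\<And>x. R < norm x \<Longrightarrow> f x = 0"
    using annularD[OF assms] by metis
  have "partial_deriv i f x = 0" if "norm x < d \<or> R < norm x" for x
  proof -
    have "open ({x. norm x < d} \<union> {x::real^'a. R < norm x})"
      by (intro open_Un open_Collect_less continuous_intros)
    then have "eventually (\<lambda>y. y \<in> {x. norm x < d} \<union> {x. R < norm x}) (nhds x)"
      using that by (intro eventually_nhds_in_open) auto
    then have "eventually (\<lambda>y. f y = 0) (nhds x)"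
      by eventually_elim (use dR in auto)
    then show ?thesis using partial_deriv_cong_nhds[of f "\<lambda>y. 0" x i] by (simp add: partial_deriv_const)
  qed
  with dR show ?thesis unfolding annular_def by blast
qed

lemma Ck0_differentiable: "Ck0 (Suc k) f \<Longrightarrow> f differentiable at x"
  unfolding Ck0_def by (blast intro: Ck_differentiable)

lemma Ck0_annular: "Ck0 k f \<Longrightarrow> annular f"
  unfolding Ck0_def by blast

lemma Ck0_partial_deriv: "Ck0 (Suc k) f \<Longrightarrow> Ck0 k (partial_deriv i f)"
  unfolding Ck0_def by (simp add: annular_partial_deriv)

lemma Ck0_mono: "Ck0 m f \<Longrightarrow> k \<le> m \<Longrightarrow> Ck0 k f"
  unfolding Ck0_def using Ck_mono by blast

lemma Ck0_mult_left: "Ck k f \<Longrightarrow> Ck0 k g \<Longrightarrow> Ck0 k (\<lambda>x. f x * g x)"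
  unfolding Ck0_def by (auto intro: Ck_mult annular_weaken)

lemma Ck0_mult: "Ck0 k f \<Longrightarrow> Ck0 k g \<Longrightarrow> Ck0 k (\<lambda>x. f x * g x)"
  by (rule Ck0_mult_left) (simp_all add: Ck0_def)

lemma Ck0_cmult: "Ck0 k g \<Longrightarrow> Ck0 k (\<lambda>x. c * g x)"
  by (rule Ck0_mult_left[OF Ck_const])

lemma Ck0_add: "Ck0 k f \<Longrightarrow> Ck0 k g \<Longrightarrow> Ck0 k (\<lambda>x. f x + g x)"
  unfolding Ck0_def by (auto intro: Ck_add annular_add)

lemma Ck0_diff:
  assumes "Ck0 k f" "Ck0 k g" shows "Ck0 k (\<lambda>x. f x - g x)"
  using Ck0_add[OF assms(1) Ck0_cmult[OF assms(2), of "-1"]] by simp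

lemma Ck0_zero: "Ck0 k (\<lambda>x. 0)"
  unfolding Ck0_def annular_def by (auto simp: Ck_const intro: exI[of _ "1::real"])

lemma Ck0_sum: "(\<And>j. j \<in> J \<Longrightarrow> Ck0 k (f j)) \<Longrightarrow> Ck0 k (\<lambda>x. \<Sum>j\<in>J. f j x)"
proof (induction J rule: infinite_finite_induct)
qed (auto intro: Ck0_add Ck0_zero)

text \<open>A support is compact and omits the origin exactly when it lies in a closed shell
  \<open>cball 0 R - ball 0 d\<close>.\<close>

lemma test_function_Ck0: "test_function f \<longleftrightarrow> (\<forall>k. Ck0 k f)"
proof -
  have "compact (closure (support_on UNIV f)) \<and> 0 \<notin> closure (support_on UNIV f) \<longleftrightarrow> annular f"
  proof
    assume *: "compact (closure (support_on UNIV f)) \<and> 0 \<notin> closure (support_on UNIV f)"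
    then obtain d where d: "d > 0" "ball 0 d \<subseteq> - closure (support_on UNIV f)"
      by (metis ComplI closed_closure open_Compl open_contains_ball)
    obtain R where R: "\<And>x. x \<in> closure (support_on UNIV f) \<Longrightarrow> norm x \<le> R"
      using * compact_imp_bounded bounded_iff by metis
    have "f x = 0" if "norm x < d \<or> R < norm x" for x
    proof -
      have "x \<notin> closure (support_on UNIV f)" using that d R by force
      then show ?thesis using closure_subset[of "support_on UNIV f"] by (auto simp: support_on_def)
    qed
    then show "annular f" unfolding annular_def using d by blast
  next
    assume "annular f"
    then obtain d R where dR: "d > 0" "\<And>x. norm x < d \<Longrightarrow> f x = 0" "\<And>x. R < norm x \<Longrightarrow> f x = 0"
      using annularD by metis
    have "support_on UNIV f \<subseteq> cball 0 R - ball 0 d"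
      using dR by (force simp: support_on_def)
    then have *: "closure (support_on UNIV f) \<subseteq> cball 0 R - ball 0 d"
      by (rule closure_minimal) auto
    then show "compact (closure (support_on UNIV f)) \<and> 0 \<notin> closure (support_on UNIV f)"
      using dR(1) by (auto simp: compact_eq_bounded_closed intro: bounded_subset[OF bounded_cball])
  qed
  then show ?thesis unfolding test_function_def Ck0_def by auto
qed

section \<open>Powers of |x| as smooth multipliers\<close>

lemma has_derivative_norm_powr:
  fixes x :: "real^'n::finite"
  assumes "x \<noteq> 0"
  shows "((\<lambda>x. norm x powr s) has_derivative (\<lambda>h. s * norm x powr (s - 2) * (x \<bullet> h))) (at x)"
proof -
  have "((\<lambda>x. norm x powr s) has_derivative
      (\<lambda>h. norm x powr s * (0 * ln (norm x) + ((sgn x) \<bullet> h) * s / norm x))) (at x)"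
    using assms has_derivative_norm[OF assms]
    by (intro has_derivative_powr) (auto simp: inner_commute[of "sgn x"])
  moreover have "norm x powr s * (0 * ln (norm x) + ((sgn x) \<bullet> h) * s / norm x)
     = s * norm x powr (s - 2) * (x \<bullet> h)" for h
    using assms by (simp add: powr_diff sgn_div_norm power2_eq_square field_simps)
  ultimately show ?thesis by simp
qed

lemma weight_deriv:
  fixes g :: "real^'n::finite \<Rightarrow> real"
  assumes "g differentiable at x" "annular g"
  shows "(\<lambda>x. norm x powr s * g x) differentiable at x" (is ?D)
    and "partial_deriv i (\<lambda>x. norm x powr s * g x) x
      = norm x powr s * partial_deriv i g x + s * norm x powr (s - 2) * x $ i * g x" (is ?P)
proof -
  have "?D \<and> ?P"
  proof (cases "x = 0")
    case True
    obtain d where d: "d > 0" "\<And>x. norm x < d \<Longrightarrow> g x = 0"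
      using annularD[OF assms(2)] by metis
    have "eventually (\<lambda>y. norm y < d) (nhds x)"
      using d True eventually_nhds_in_open[of "ball 0 d" x] by simp
    then have ev: "eventually (\<lambda>y. norm y powr s * g y = 0) (nhds x)"
      by eventually_elim (simp add: d)
    have "((\<lambda>y. norm y powr s * g y) has_derivative (\<lambda>_. 0)) (at x)
      \<longleftrightarrow> ((\<lambda>y. 0) has_derivative (\<lambda>_::real^'n. 0::real)) (at x)"
      using ev by (rule has_derivative_cong_nhds)
    then show ?thesis
      using partial_deriv_eqI[of "\<lambda>x. norm x powr s * g x" "\<lambda>_. 0" x i] d True
      by (auto simp: differentiable_def)
  next
    case False
    note D = has_derivative_norm_powr[OF False, of s]
    then have d: "(\<lambda>x. norm x powr s) differentiable at x" by (auto simp: differentiable_def)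
    show ?thesis
      using d assms(1) by (simp add: partial_deriv_mult partial_deriv_eqI[OF D] cart_eq_inner_axis)
  qed
  then show ?D ?P by auto
qed

text \<open>A derivative can lower the exponent by 2 while multiplying \<open>g\<close> by a
  coordinate, so the induction runs over all \<open>g\<close> and \<open>s\<close> at once.
  Continuity is glued from a ball on which the product vanishes and the punctured space, where the
  weight is continuous.\<close>

lemma Ck0_weight: "Ck0 k g \<Longrightarrow> Ck0 k (\<lambda>x. norm x powr s * g x)"
proof (induction k arbitrary: g s)
  case 0
  then have c: "continuous_on UNIV g" and a: "annular g" by (auto simp: Ck0_def)
  obtain d where d: "d > 0" "\<And>x. norm x < d \<Longrightarrow> g x = 0"
    using annularD[OF a] by metis
  have "continuous_on ({x. norm x < d} \<union> {x. norm x > 0}) (\<lambda>x. norm x powr s * g x)"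
  proof (rule continuous_on_open_Un)
    show "continuous_on {x. norm x < d} (\<lambda>x. norm x powr s * g x)"
      by (subst continuous_on_cong[OF refl, of _ _ "\<lambda>x. 0"]) (auto simp: d)
    show "continuous_on {x. norm x > 0} (\<lambda>x. norm x powr s * g x)"
      by (intro continuous_intros continuous_on_subset[OF c]) auto
  qed (intro open_Collect_less continuous_intros)+
  moreover have "{x. norm x < d} \<union> {x. norm x > 0} = (UNIV :: (real^'a) set)"
    using d(1) by auto
  ultimately show ?case using a by (simp add: Ck0_def annular_weaken)
next
  case (Suc k)
  note a = Ck0_annular[OF Suc.prems]
  have eq: "partial_deriv i (\<lambda>x. norm x powr s * g x)
      = (\<lambda>x. norm x powr s * partial_deriv i g x + norm x powr (s - 2) * (s * (x $ i * g x)))" for i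
    using weight_deriv(2)[OF Ck0_differentiable[OF Suc.prems] a] by (auto simp: mult_ac)
  have "Ck0 k (partial_deriv i (\<lambda>x. norm x powr s * g x))" for i
    unfolding eq using Suc.prems
    by (intro Ck0_add Suc.IH Ck0_partial_deriv Ck0_cmult Ck0_mult_left[OF Ck_component])
      (auto intro: Ck0_mono)
  then have "Ck (Suc k) (\<lambda>x. norm x powr s * g x)"
    using weight_deriv(1)[OF Ck0_differentiable[OF Suc.prems] a] by (intro Ck_SucI) (auto simp: Ck0_def)
  then show ?case using a by (simp add: Ck0_def annular_weaken)
qed

section \<open>Mixed derivatives and integration by parts\<close>

lemma DERIV_along_axis:
  fixes g :: "real^'n::finite \<Rightarrow> real"
  assumes "\<And>y. g differentiable at y"
  shows "((\<lambda>t. g (y + t *\<^sub>R axis i 1)) has_real_derivative partial_deriv i g (y + t *\<^sub>R axis i 1)) (at t)"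
proof -
  let ?D = "frechet_derivative g (at (y + t *\<^sub>R axis i 1))"
  have D: "(g has_derivative ?D) (at (y + t *\<^sub>R axis i 1))"
    by (rule has_derivative_frechet[OF assms])
  have "((\<lambda>t. g (y + t *\<^sub>R axis i 1)) has_derivative (\<lambda>s. ?D (s *\<^sub>R axis i 1))) (at t)"
    by (rule has_derivative_compose[where f="\<lambda>t. y + t *\<^sub>R axis i 1" and g=g, OF _ D]) (auto intro!: derivative_eq_intros)
  moreover have "?D (s *\<^sub>R axis i 1) = partial_deriv i g (y + t *\<^sub>R axis i 1) * s" for s
    using linear_scale[OF has_derivative_linear[OF D]] by (simp add: partial_deriv_def)
  ultimately show ?thesis by (simp add: has_field_derivative_def)
qed

lemma MVT_along_axis:
  fixes g :: "real^'n::finite \<Rightarrow> real"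
  assumes "\<And>y. g differentiable at y" "0 < h"
  obtains s where "0 < s" "s < h" "g (y + h *\<^sub>R axis i 1) - g y = h * partial_deriv i g (y + s *\<^sub>R axis i 1)"
proof -
  have "\<exists>z>0. z < h \<and> g (y + h *\<^sub>R axis i 1) - g (y + 0 *\<^sub>R axis i 1) = (h - 0) * partial_deriv i g (y + z *\<^sub>R axis i 1)"
    using assms(2) by (intro MVT2) (auto intro: DERIV_along_axis[OF assms(1)])
  then show ?thesis using that by auto
qed

text \<open>Two mean value steps: along \<open>i\<close> for the increment of \<open>f\<close> in
  direction \<open>j\<close>, then along \<open>j\<close> for \<open>partial_deriv i f\<close>. The
  left-hand side is symmetric in \<open>i\<close> and \<open>j\<close>, the right-hand side is not;
  this is what makes mixed derivatives comparable.\<close>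

lemma second_difference:
  fixes f :: "real^'n::finite \<Rightarrow> real"
  assumes f: "Ck (Suc (Suc 0)) f" and "0 < h"
  obtains s t where "0 < s" "s < h" "0 < t" "t < h"
    "f (x + h *\<^sub>R axis j 1 + h *\<^sub>R axis i 1) - f (x + h *\<^sub>R axis i 1) - f (x + h *\<^sub>R axis j 1) + f x
      = h * (h * partial_deriv j (partial_deriv i f) (x + s *\<^sub>R axis i 1 + t *\<^sub>R axis j 1))"
proof -
  let ?d = "h *\<^sub>R axis j 1 :: real^'n"
  have df: "f differentiable at y" for y using f by (rule Ck_differentiable)
  have ddf: "partial_deriv i f differentiable at y" for y
    using Ck_partial_deriv[OF f] by (rule Ck_differentiable)
  have shift: "((\<lambda>y. f (y + ?d)) has_derivative frechet_derivative f (at (y + ?d))) (at y)" for y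
    by (rule has_derivative_compose[where f="\<lambda>y. y + ?d" and g=f, OF _ has_derivative_frechet[OF df]]) (auto intro!: derivative_eq_intros)
  have dsh: "(\<lambda>y. f (y + ?d)) differentiable at y" for y
    using shift by (auto simp: differentiable_def)
  have psh: "partial_deriv i (\<lambda>y. f (y + ?d)) y = partial_deriv i f (y + ?d)" for y
    by (subst partial_deriv_eqI[OF shift]) (simp add: partial_deriv_def)
  let ?g = "\<lambda>y. f (y + ?d) + (-1) * f y"
  have dg: "?g differentiable at y" for y
    by (intro differentiable_add dsh differentiable_mult df differentiable_const)
  have pg: "partial_deriv i ?g y = partial_deriv i f (y + ?d) - partial_deriv i f y" for y
    using dsh df by (simp only: partial_deriv_add partial_deriv_cmult differentiable_mult differentiable_const psh)
  obtain s where s: "0 < s" "s < h"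
    "?g (x + h *\<^sub>R axis i 1) - ?g x = h * partial_deriv i ?g (x + s *\<^sub>R axis i 1)"
    by (rule MVT_along_axis[OF dg \<open>0 < h\<close>, of x i])
  obtain t where t: "0 < t" "t < h"
    "partial_deriv i f (x + s *\<^sub>R axis i 1 + ?d) - partial_deriv i f (x + s *\<^sub>R axis i 1)
      = h * partial_deriv j (partial_deriv i f) (x + s *\<^sub>R axis i 1 + t *\<^sub>R axis j 1)"
    by (rule MVT_along_axis[OF ddf \<open>0 < h\<close>, of "x + s *\<^sub>R axis i 1" j])
  show ?thesis
    by (rule that[OF s(1,2) t(1,2)], use s(3) in \<open>unfold pg t(3)\<close>) (simp add: algebra_simps)
qed

text \<open>Schwarz's theorem. The second difference is evaluated in both orders with step
  \<open>1 / (n + 1)\<close>; the two intermediate points tend to \<open>x\<close>, and continuity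
  of the second derivatives gives equality in the limit.\<close>

lemma partial_deriv_commute:
  fixes f :: "real^'n::finite \<Rightarrow> real"
  assumes f: "Ck (Suc (Suc 0)) f"
  shows "partial_deriv i (partial_deriv j f) x = partial_deriv j (partial_deriv i f) x"
proof -
  let ?h = "\<lambda>n. inverse (real (Suc n))"
  have "\<exists>s t s' t'. (0 < s \<and> s < ?h n \<and> 0 < t \<and> t < ?h n \<and> 0 < s' \<and> s' < ?h n \<and> 0 < t' \<and> t' < ?h n) \<and>
     partial_deriv j (partial_deriv i f) (x + s *\<^sub>R axis i 1 + t *\<^sub>R axis j 1)
     = partial_deriv i (partial_deriv j f) (x + s' *\<^sub>R axis j 1 + t' *\<^sub>R axis i 1)" for n
  proof -
    have "0 < ?h n" by simp
    obtain s t where 1: "0 < s" "s < ?h n" "0 < t" "t < ?h n"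
      "f (x + ?h n *\<^sub>R axis j 1 + ?h n *\<^sub>R axis i 1) - f (x + ?h n *\<^sub>R axis i 1) - f (x + ?h n *\<^sub>R axis j 1) + f x
      = ?h n * (?h n * partial_deriv j (partial_deriv i f) (x + s *\<^sub>R axis i 1 + t *\<^sub>R axis j 1))"
      using second_difference[OF f \<open>0 < ?h n\<close>] by metis
    obtain s' t' where 2: "0 < s'" "s' < ?h n" "0 < t'" "t' < ?h n"
      "f (x + ?h n *\<^sub>R axis i 1 + ?h n *\<^sub>R axis j 1) - f (x + ?h n *\<^sub>R axis j 1) - f (x + ?h n *\<^sub>R axis i 1) + f x
      = ?h n * (?h n * partial_deriv i (partial_deriv j f) (x + s' *\<^sub>R axis j 1 + t' *\<^sub>R axis i 1))"
      using second_difference[OF f \<open>0 < ?h n\<close>] by metis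
    have "?h n * (?h n * partial_deriv j (partial_deriv i f) (x + s *\<^sub>R axis i 1 + t *\<^sub>R axis j 1))
      = ?h n * (?h n * partial_deriv i (partial_deriv j f) (x + s' *\<^sub>R axis j 1 + t' *\<^sub>R axis i 1))"
      unfolding 1(5)[symmetric] 2(5)[symmetric] by (simp add: add.commute add.left_commute)
    then show ?thesis using 1 2 \<open>0 < ?h n\<close> by (metis mult_left_cancel less_irrefl)
  qed
  then obtain s t s' t' where *:
     "\<And>n. 0 < s n \<and> s n < ?h n \<and> 0 < t n \<and> t n < ?h n \<and> 0 < s' n \<and> s' n < ?h n \<and> 0 < t' n \<and> t' n < ?h n"
     "\<And>n. partial_deriv j (partial_deriv i f) (x + s n *\<^sub>R axis i 1 + t n *\<^sub>R axis j 1)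
     = partial_deriv i (partial_deriv j f) (x + s' n *\<^sub>R axis j 1 + t' n *\<^sub>R axis i 1)"
    by metis
  have h0: "?h \<longlonglongrightarrow> 0" by (rule LIMSEQ_inverse_real_of_nat)
  have lim0: "r \<longlonglongrightarrow> 0" if "\<And>n. 0 < r n \<and> r n < ?h n" for r
    by (rule tendsto_sandwich[OF _ _ tendsto_const h0]) (use that in \<open>auto intro!: always_eventually less_imp_le\<close>)
  have "s \<longlonglongrightarrow> 0" "t \<longlonglongrightarrow> 0" "s' \<longlonglongrightarrow> 0" "t' \<longlonglongrightarrow> 0" using * by (auto intro: lim0)
  have l: "(\<lambda>n. x + s n *\<^sub>R axis i 1 + t n *\<^sub>R axis j 1) \<longlonglongrightarrow> x + 0 *\<^sub>R axis i 1 + 0 *\<^sub>R axis j 1"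
    "(\<lambda>n. x + s' n *\<^sub>R axis j 1 + t' n *\<^sub>R axis i 1) \<longlonglongrightarrow> x + 0 *\<^sub>R axis j 1 + 0 *\<^sub>R axis i 1"
    using \<open>s \<longlonglongrightarrow> 0\<close> \<open>t \<longlonglongrightarrow> 0\<close> \<open>s' \<longlonglongrightarrow> 0\<close> \<open>t' \<longlonglongrightarrow> 0\<close>
    by - (intro tendsto_add tendsto_scaleR tendsto_const; assumption)+
  have c: "isCont (partial_deriv a (partial_deriv b f)) x" for a b
  proof -
    have "continuous_on UNIV (partial_deriv a (partial_deriv b f))"
      by (rule Ck_continuous[of 0]) (intro Ck_partial_deriv f)
    then show ?thesis by (simp add: continuous_on_eq_continuous_at)
  qed
  have "(\<lambda>n. partial_deriv i (partial_deriv j f) (x + s' n *\<^sub>R axis j 1 + t' n *\<^sub>R axis i 1))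
      \<longlonglongrightarrow> partial_deriv i (partial_deriv j f) x"
    using isCont_tendsto_compose[OF c l(2)[simplified]] by simp
  moreover have "(\<lambda>n. partial_deriv i (partial_deriv j f) (x + s' n *\<^sub>R axis j 1 + t' n *\<^sub>R axis i 1))
      \<longlonglongrightarrow> partial_deriv j (partial_deriv i f) x"
    using isCont_tendsto_compose[OF c l(1)[simplified]] by (simp flip: *(2))
  ultimately show ?thesis by (rule LIMSEQ_unique)
qed

section \<open>Integrability, and vanishing of integrals of derivatives\<close>

lemma Ck0_bounded:
  fixes f :: "real^'n::finite \<Rightarrow> real"
  assumes "Ck0 k f"
  obtains C where "C > 0" "\<And>x. \<bar>f x\<bar> \<le> C"
proof -
  have c: "continuous_on UNIV f" and a: "annular f"
    using assms unfolding Ck0_def by (metis Ck_continuous)+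
  obtain R where R: "\<And>x. R < norm x \<Longrightarrow> f x = 0" using annularD[OF a] by metis
  have "compact (f ` cball 0 R)"
    by (intro compact_continuous_image continuous_on_subset[OF c]) auto
  then obtain C where C: "\<And>x. x \<in> cball 0 R \<Longrightarrow> \<bar>f x\<bar> \<le> C"
    using compact_imp_bounded bounded_iff[of "f ` cball 0 R"] by fastforce
  have "\<bar>f x\<bar> \<le> max C 1" for x using R[of x] C[of x] by (cases "norm x \<le> R") auto
  then show ?thesis by (intro that[of "max C 1"]) auto
qed

lemma Ck0_borel_measurable: "Ck0 k f \<Longrightarrow> f \<in> borel_measurable borel"
  unfolding Ck0_def by (blast intro: borel_measurable_continuous_onI Ck_continuous)

lemma Ck0_integrable_lborel:
  assumes "Ck0 k f" shows "integrable lborel f"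
proof -
  obtain R where R: "\<And>x. R < norm x \<Longrightarrow> f x = 0" using annularD[OF Ck0_annular[OF assms]] by metis
  have "set_integrable lborel (cball 0 R) f"
    unfolding set_integrable_def using assms
    by (intro borel_integrable_compact continuous_on_subset[OF Ck_continuous[of k] subset_UNIV])
      (simp_all add: Ck0_def)
  moreover have "(\<lambda>x. indicator (cball 0 R) x *\<^sub>R f x) = f"
    by (rule ext) (use R in \<open>force simp: indicator_def\<close>)
  ultimately show ?thesis by (simp add: set_integrable_def)
qed

lemma Ck0_integrable: "Ck0 k f \<Longrightarrow> integrable lebesgue f"
  by (simp add: integrable_completion Ck0_borel_measurable Ck0_integrable_lborel)

text \<open>By translation invariance every difference quotient \<open>F n\<close> has integral 0.
  The mean value theorem bounds \<open>F n\<close> by the supremum of the derivative, so dominated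
  convergence carries the 0 over to the derivative.\<close>

lemma integral_partial_deriv:
  fixes f :: "real^'n::finite \<Rightarrow> real"
  assumes f: "Ck0 (Suc 0) f"
  shows "(LINT x|lebesgue. partial_deriv i f x) = 0"
proof -
  let ?e = "axis i 1 :: real^'n"
  let ?h = "\<lambda>n. inverse (real (Suc n))"
  have df: "\<And>x. f differentiable at x" by (rule Ck0_differentiable[OF f])
  note bm = Ck0_borel_measurable[OF f, measurable]
  have p0: "Ck0 0 (partial_deriv i f)" using f by (rule Ck0_partial_deriv)
  note pm = Ck0_borel_measurable[OF p0, measurable]
  obtain C where C: "C > 0" "\<And>x. \<bar>partial_deriv i f x\<bar> \<le> C" using Ck0_bounded[OF p0] by metis
  obtain R where R: "\<And>x. R < norm x \<Longrightarrow> f x = 0" using annularD[OF Ck0_annular[OF f]] by metis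
  define F where "F n x = (f (x + ?h n *\<^sub>R ?e) - f x) / ?h n" for n x
  have tr: "integrable lborel (\<lambda>x. f (x + c))" "(\<integral>x. f (x + c) \<partial>lborel) = (\<integral>x. f x \<partial>lborel)" for c
  proof -
    have "integrable (distr lborel borel ((+) c)) f"
      by (subst lborel_distr_plus) (rule Ck0_integrable_lborel[OF f])
    then show "integrable lborel (\<lambda>x. f (x + c))"
      by (subst (asm) integrable_distr_eq) (auto simp: add.commute)
    have "(\<integral>x. f x \<partial>lborel) = (\<integral>x. f x \<partial>distr lborel borel ((+) c))"
      by (subst lborel_distr_plus) simp
    also have "\<dots> = (\<integral>x. f (x + c) \<partial>lborel)" by (subst integral_distr) (auto simp: add.commute)
    finally show "(\<integral>x. f (x + c) \<partial>lborel) = (\<integral>x. f x \<partial>lborel)" by simp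
  qed
  have "(\<integral>x. F n x \<partial>lborel) = 0" for n
    unfolding F_def using tr Ck0_integrable_lborel[OF f] by (simp add: Bochner_Integration.integral_diff)
  \<comment> \<open>The radius \<open>R + 1\<close> in the dominating function leaves room for the
    shift by \<open>?h n\<close>, which is at most 1.\<close>
  moreover have "(\<lambda>n. \<integral>x. F n x \<partial>lborel) \<longlonglongrightarrow> (\<integral>x. partial_deriv i f x \<partial>lborel)"
  proof (rule integral_dominated_convergence[where w="\<lambda>x. C * indicator (cball 0 (R + 1)) x"])
    show "integrable lborel (\<lambda>x::real^'n. C * indicator (cball 0 (R + 1)) x)"
      by (intro integrable_mult_right integrable_real_indicator)
        (use emeasure_bounded_finite[OF bounded_cball, of "0::real^'n" "R + 1"] in simp_all)
    show "AE x in lborel. (\<lambda>n. F n x) \<longlonglongrightarrow> partial_deriv i f x"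
    proof (rule AE_I2)
      fix x
      have "((\<lambda>h. (f (x + (0 + h) *\<^sub>R ?e) - f (x + 0 *\<^sub>R ?e)) / h) \<longlongrightarrow> partial_deriv i f (x + 0 *\<^sub>R ?e)) (at 0)"
        using DERIV_along_axis[OF df, of x i 0] unfolding DERIV_def .
      moreover have "filterlim ?h (at 0) sequentially"
        using LIMSEQ_inverse_real_of_nat by (simp add: filterlim_at)
      ultimately have "((\<lambda>n. (f (x + (0 + ?h n) *\<^sub>R ?e) - f (x + 0 *\<^sub>R ?e)) / ?h n) \<longlongrightarrow> partial_deriv i f (x + 0 *\<^sub>R ?e)) sequentially"
        by (rule filterlim_compose)
      then show "(\<lambda>n. F n x) \<longlonglongrightarrow> partial_deriv i f x" by (simp add: F_def)
    qed
    show "AE x in lborel. norm (F n x) \<le> C * indicator (cball 0 (R + 1)) x" for n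
    proof (rule AE_I2)
      fix x
      show "norm (F n x) \<le> C * indicator (cball 0 (R + 1)) x"
      proof (cases "norm x \<le> R + 1")
        case True
        obtain s where "f (x + ?h n *\<^sub>R ?e) - f x = ?h n * partial_deriv i f (x + s *\<^sub>R ?e)"
          using MVT_along_axis[OF df, of "?h n" x i] by auto
        then have "F n x = partial_deriv i f (x + s *\<^sub>R ?e)" unfolding F_def by simp
        then show ?thesis using C(2) True by (simp add: indicator_def)
      next
        case False
        have "norm x \<le> norm (x + ?h n *\<^sub>R ?e) + norm (?h n *\<^sub>R ?e)"
          using norm_triangle_ineq4[of "x + ?h n *\<^sub>R ?e" "?h n *\<^sub>R ?e"] by simp
        moreover have "norm (?h n *\<^sub>R ?e) \<le> 1" by (simp add: field_simps)
        ultimately have "f (x + ?h n *\<^sub>R ?e) = 0" "f x = 0" using False by (auto intro!: R)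
        then show ?thesis using C(1) by (simp add: F_def)
      qed
    qed
  qed (auto simp: F_def)
  ultimately have "(\<integral>x. partial_deriv i f x \<partial>lborel) = 0"
    by (simp add: LIMSEQ_const_iff)
  then show ?thesis by (simp add: integral_completion)
qed

section \<open>The Rellich-type identity\<close>

definition lap :: "(real^'n::finite \<Rightarrow> real) \<Rightarrow> real^'n \<Rightarrow> real" where
  "lap w x = (\<Sum>i\<in>UNIV. partial_deriv i (partial_deriv i w) x)"

text \<open>The generator of dilations, \<open>r d/dr\<close>.\<close>

definition euler :: "(real^'n::finite \<Rightarrow> real) \<Rightarrow> real^'n \<Rightarrow> real" where
  "euler w x = (\<Sum>j\<in>UNIV. x $ j * partial_deriv j w x)"

section \<open>Green's formula for the weighted operator\<close>

lemma wdiv_sum: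
  "wdiv \<alpha> f x = (\<Sum>i\<in>UNIV. partial_deriv i (\<lambda>y. norm y powr \<alpha> * partial_deriv i f y) x)"
  by (simp add: wdiv_def divergence_def grad_def)

lemma Ck0_wdiv: "Ck0 (Suc (Suc k)) f \<Longrightarrow> Ck0 k (wdiv \<alpha> f)"
  unfolding wdiv_sum[abs_def] by (intro Ck0_sum Ck0_partial_deriv Ck0_weight)

lemma wdiv_diff:
  assumes f: "Ck0 (Suc (Suc 0)) f" and g: "Ck0 (Suc (Suc 0)) g"
  shows "wdiv \<alpha> (\<lambda>x. f x - g x) x = wdiv \<alpha> f x - wdiv \<alpha> g x"
proof -
  have *: "partial_deriv i (\<lambda>x. f x - g x) x = partial_deriv i f x - partial_deriv i g x"
    if "f differentiable at x" "g differentiable at x" for i x and f g :: "real^'a \<Rightarrow> real"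
    using partial_deriv_add[OF that(1) differentiable_mult[OF differentiable_const that(2)], of i "-1"]
      partial_deriv_cmult[OF that(2), of i "-1"] by simp
  have d: "f differentiable at x" "g differentiable at x" for x
    using f g by (auto intro: Ck0_differentiable)
  have "(\<lambda>y. norm y powr \<alpha> * partial_deriv i (\<lambda>x. f x - g x) y)
    = (\<lambda>y. norm y powr \<alpha> * partial_deriv i f y - norm y powr \<alpha> * partial_deriv i g y)" for i
    using d by (simp add: * algebra_simps)
  moreover have "(\<lambda>y. norm y powr \<alpha> * partial_deriv i f y) differentiable at x"
    "(\<lambda>y. norm y powr \<alpha> * partial_deriv i g y) differentiable at x" for i x
    by (intro Ck0_differentiable[of 0] Ck0_weight Ck0_partial_deriv f g)+
  ultimately show ?thesis by (simp add: wdiv_sum * sum_subtractf)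
qed

lemma integral_divergence:
  assumes "\<And>i. Ck0 (Suc 0) (G i)"
  shows "(LINT x|lebesgue. (\<Sum>i\<in>UNIV. partial_deriv i (G i) x)) = 0"
proof -
  have "integrable lebesgue (partial_deriv i (G i))" for i
    by (rule Ck0_integrable[OF Ck0_partial_deriv[OF assms]])
  then show ?thesis by (simp add: Bochner_Integration.integral_sum integral_partial_deriv[OF assms])
qed

text \<open>The divergence of \<open>|x|^\<alpha> g grad f\<close> has integral 0. The resulting
  right-hand side is symmetric in \<open>f\<close> and \<open>g\<close>, which is what allows the
  operator to be moved from one factor to the other.\<close>

lemma wdiv_weak_form:
  assumes f: "Ck0 (Suc (Suc 0)) f" and g: "Ck0 (Suc (Suc 0)) g"
  shows "(LINT x|lebesgue. wdiv \<alpha> f x * g x)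
    = - (LINT x|lebesgue. norm x powr \<alpha> * (\<Sum>i\<in>UNIV. partial_deriv i f x * partial_deriv i g x))"
proof -
  let ?F = "\<lambda>i x. norm x powr \<alpha> * partial_deriv i f x"
  have F: "Ck0 (Suc 0) (?F i)" for i by (intro Ck0_weight Ck0_partial_deriv f)
  have g1: "Ck0 (Suc 0) g" using g by (rule Ck0_mono) simp
  have G: "Ck0 (Suc 0) (\<lambda>x. ?F i x * g x)" for i by (intro Ck0_mult F g1)
  have "(\<Sum>i\<in>UNIV. partial_deriv i (\<lambda>x. ?F i x * g x) x)
     = wdiv \<alpha> f x * g x + norm x powr \<alpha> * (\<Sum>i\<in>UNIV. partial_deriv i f x * partial_deriv i g x)" for x
    using Ck0_differentiable[OF F] Ck0_differentiable[OF g1]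
    by (simp add: partial_deriv_mult wdiv_sum sum.distrib sum_distrib_left sum_distrib_right mult_ac)
  moreover have "integrable lebesgue (\<lambda>x. wdiv \<alpha> f x * g x)"
    by (rule Ck0_integrable[of 0]) (intro Ck0_mult Ck0_wdiv f Ck0_mono[OF g], simp)
  moreover have "integrable lebesgue (\<lambda>x. norm x powr \<alpha> * (\<Sum>i\<in>UNIV. partial_deriv i f x * partial_deriv i g x))"
    by (rule Ck0_integrable[of "Suc 0"]) (intro Ck0_weight Ck0_sum Ck0_mult Ck0_partial_deriv f g)
  ultimately show ?thesis using integral_divergence[where G="\<lambda>i x. ?F i x * g x", OF G] by simp
qed

lemma wdiv_symmetric:
  assumes f: "Ck0 (Suc (Suc 0)) f" and g: "Ck0 (Suc (Suc 0)) g"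
  shows "(LINT x|lebesgue. wdiv \<alpha> f x * g x) = (LINT x|lebesgue. f x * wdiv \<alpha> g x)"
  using wdiv_weak_form[OF f g] wdiv_weak_form[OF g f] by (simp add: mult.commute)

section \<open>Conjugation with powers of |x|, and the vanishing cross term\<close>

lemma sum_component_squares: "(\<Sum>i\<in>UNIV. x $ i * x $ i) = (norm x)\<^sup>2" for x :: "real^'n::finite"
  by (simp add: power2_norm_eq_inner inner_vec_def)

lemma norm_powr_Suc2:
  assumes "x \<noteq> 0" "b = a + 2"
  shows "norm x powr b = norm x powr a * (norm x)\<^sup>2"
  using assms by (simp add: powr_add)

text \<open>One common power of \<open>norm x\<close> comes out, and what remains acts on
  \<open>w\<close> by an operator invariant under dilations. It is used with
  \<open>s = - A/2\<close> and \<open>s = - B/2\<close>, where only the sign of one first-order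
  contribution will differ.\<close>

lemma wdiv_weight:
  fixes w :: "real^'n::finite \<Rightarrow> real"
  assumes w: "Ck0 (Suc (Suc 0)) w"
  shows "wdiv \<alpha> (\<lambda>x. norm x powr s * w x) x = norm x powr (\<alpha> + s - 2) *
    ((norm x)\<^sup>2 * lap w x + (\<alpha> + 2 * s) * euler w x + s * (\<alpha> + s - 2 + CARD('n)) * w x)"
proof -
  let ?D = "\<lambda>i. partial_deriv i w"
  have w1: "Ck0 (Suc 0) w" using w by (rule Ck0_mono) simp
  have D: "Ck0 (Suc 0) (?D i)" for i by (rule Ck0_partial_deriv[OF w])
  have X: "Ck0 (Suc 0) (\<lambda>x. s * (x $ i * w x))" for i
    by (intro Ck0_cmult Ck0_mult_left Ck_component w1)
  have comp: "(\<lambda>x::real^'n. x $ i) differentiable at x" for i x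
    using has_derivative_component by (auto simp: differentiable_def)
  note dw = Ck0_differentiable[OF w1] and dD = Ck0_differentiable[OF D] and dX = Ck0_differentiable[OF X]
  have "(\<lambda>x. norm x powr \<alpha> * partial_deriv i (\<lambda>x. norm x powr s * w x) x)
      = (\<lambda>x. norm x powr (\<alpha> + s) * ?D i x + norm x powr (\<alpha> + s - 2) * (s * (x $ i * w x)))" for i
    unfolding weight_deriv(2)[OF dw Ck0_annular[OF w1]] by (simp add: powr_add powr_diff algebra_simps)
  moreover have "partial_deriv i (\<lambda>x. norm x powr (\<alpha> + s) * ?D i x + norm x powr (\<alpha> + s - 2) * (s * (x $ i * w x))) x
     = norm x powr (\<alpha> + s) * partial_deriv i (?D i) x + (\<alpha> + s) * norm x powr (\<alpha> + s - 2) * x $ i * ?D i x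
       + norm x powr (\<alpha> + s - 2) * (s * (x $ i * ?D i x + w x))
       + (\<alpha> + s - 2) * norm x powr (\<alpha> + s - 2 - 2) * x $ i * (s * (x $ i * w x))" for i
    by (simp add: partial_deriv_add weight_deriv dD dX Ck0_annular[OF D] Ck0_annular[OF X]
        partial_deriv_cmult differentiable_mult comp dw)
       (simp add: partial_deriv_mult comp dw partial_deriv_component)
  ultimately have *: "wdiv \<alpha> (\<lambda>x. norm x powr s * w x) x = (\<Sum>i\<in>UNIV.
      norm x powr (\<alpha> + s) * partial_deriv i (?D i) x + (\<alpha> + s) * norm x powr (\<alpha> + s - 2) * x $ i * ?D i x
       + norm x powr (\<alpha> + s - 2) * (s * (x $ i * ?D i x + w x))
       + (\<alpha> + s - 2) * norm x powr (\<alpha> + s - 2 - 2) * x $ i * (s * (x $ i * w x)))"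
    unfolding wdiv_sum by simp
  show ?thesis
  proof (cases "x = 0")
    case True
    then show ?thesis unfolding * by simp
  next
    case False
    \<comment> \<open>The lowest exponent that occurs; the other weights are \<open>?P\<close> times
      powers of \<open>(norm x)^2\<close>, so the rest is polynomial algebra.\<close>
    let ?P = "norm x powr (\<alpha> + s - 2 - 2)"
    have e: "norm x powr (\<alpha> + s - 2) = ?P * (norm x)\<^sup>2"
      "norm x powr (\<alpha> + s) = ?P * (norm x)\<^sup>2 * (norm x)\<^sup>2"
      by (simp_all add: norm_powr_Suc2[OF False, of "\<alpha> + s - 2" "\<alpha> + s - 2 - 2"]
          norm_powr_Suc2[OF False, of "\<alpha> + s" "\<alpha> + s - 2"] del: diff_diff_eq)
    have "wdiv \<alpha> (\<lambda>x. norm x powr s * w x) x = (\<Sum>i\<in>UNIV.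
       ?P * (norm x)\<^sup>2 * (norm x)\<^sup>2 * partial_deriv i (?D i) x
       + ?P * (norm x)\<^sup>2 * (\<alpha> + 2 * s) * (x $ i * ?D i x) + ?P * (norm x)\<^sup>2 * s * w x
       + ?P * (\<alpha> + s - 2) * s * w x * (x $ i * x $ i))"
      unfolding * e by (intro sum.cong refl) (simp add: algebra_simps)
    also have "\<dots> = ?P * (norm x)\<^sup>2 * (norm x)\<^sup>2 * lap w x
       + ?P * (norm x)\<^sup>2 * (\<alpha> + 2 * s) * euler w x + CARD('n) * (?P * (norm x)\<^sup>2 * s * w x)
       + ?P * (\<alpha> + s - 2) * s * w x * (norm x)\<^sup>2"
      unfolding sum_component_squares[symmetric] lap_def euler_def
      by (simp add: sum.distrib sum_distrib_left)
    also have "\<dots> = ?P * (norm x)\<^sup>2 *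
       ((norm x)\<^sup>2 * lap w x + (\<alpha> + 2 * s) * euler w x + s * (\<alpha> + s - 2 + CARD('n)) * w x)"
      by (simp add: algebra_simps)
    finally show ?thesis unfolding e .
  qed
qed

text \<open>In \<open>t = log r\<close> the second factor is \<open>w_tt\<close> plus the spherical
  Laplacian of \<open>w\<close> minus \<open>c w\<close>. Its product with \<open>w_t\<close> is,
  after integration over the sphere, the \<open>t\<close>-derivative of half of
  \<open>w_t^2 - |grad_S w|^2 - c w^2\<close>. The proof writes the same fact in Cartesian form, as
  the divergence of the field \<open>G\<close>.\<close>

lemma integral_euler_identity:
  fixes w :: "real^'n::finite \<Rightarrow> real" and c :: real
  defines "N \<equiv> real CARD('n)"
  assumes w: "Ck0 (Suc (Suc 0)) w"
  shows "(LINT x|lebesgue. norm x powr (- N) *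
    (euler w x * ((norm x)\<^sup>2 * lap w x - (N - 2) * euler w x - c * w x))) = 0"
proof -
  let ?D = "\<lambda>i. partial_deriv i w"
  let ?H = "\<lambda>i j. partial_deriv i (partial_deriv j w)"
  define S where "S x = (\<Sum>j\<in>UNIV. ?D j x * ?D j x)" for x
  have w1: "Ck0 (Suc 0) w" using w by (rule Ck0_mono) simp
  have D: "Ck0 (Suc 0) (?D i)" for i by (rule Ck0_partial_deriv[OF w])
  have E: "Ck0 (Suc 0) (euler w)"
    unfolding euler_def[abs_def] by (intro Ck0_sum Ck0_mult_left Ck_component D)
  have S: "Ck0 (Suc 0) S" unfolding S_def[abs_def] by (intro Ck0_sum Ck0_mult D)
  have comp: "(\<lambda>x::real^'n. x $ i) differentiable at x" for i x
    using has_derivative_component by (auto simp: differentiable_def)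
  note dw = Ck0_differentiable[OF w1] and dD = Ck0_differentiable[OF D]
    and dE = Ck0_differentiable[OF E] and dS = Ck0_differentiable[OF S]
  \<comment> \<open>The Pohozaev field: its divergence is
    \<open>euler w * lap w + (1 - N/2) * S\<close>. Differentiating the weight
    \<open>norm x powr (2 - N)\<close> cancels the \<open>S\<close> term exactly and contributes
    \<open>- (N - 2) * (euler w)^2\<close>.\<close>
  define g1 where "g1 i x = euler w x * ?D i x + (-1/2) * (x $ i * S x)" for i x
  \<comment> \<open>Off the origin \<open>x |x|^(-N)\<close> is divergence free, so with this weight
    only \<open>- c * w * euler w\<close> survives.\<close>
  define g2 where "g2 i x = (-c/2) * (x $ i * (w x * w x))" for i x
  have g1: "Ck0 (Suc 0) (g1 i)" and g2: "Ck0 (Suc 0) (g2 i)" for i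
    unfolding g1_def[abs_def] g2_def[abs_def]
    by (intro Ck0_add Ck0_mult E D Ck0_cmult Ck0_mult_left[OF Ck_component] S w1)+
  define G where "G i x = norm x powr (2 - N) * g1 i x + norm x powr (- N) * g2 i x" for i x
  have G: "Ck0 (Suc 0) (G i)" for i
    unfolding G_def[abs_def] by (intro Ck0_add Ck0_weight g1 g2)
  have pE: "partial_deriv i (euler w) x = ?D i x + (\<Sum>j\<in>UNIV. x $ j * ?H i j x)" for i x
  proof -
    have "partial_deriv i (euler w) x = (\<Sum>j\<in>UNIV. x $ j * ?H i j x + (if i = j then 1 else 0) * ?D j x)"
      unfolding euler_def[abs_def]
      by (subst partial_deriv_sum) (simp_all add: partial_deriv_mult partial_deriv_component comp dD differentiable_mult)
    then show ?thesis by (simp add: sum.distrib if_distrib[of "\<lambda>z. z * _"] cong: if_cong)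
  qed
  have pS: "partial_deriv i S x = 2 * (\<Sum>j\<in>UNIV. ?D j x * ?H i j x)" for i x
    unfolding S_def[abs_def]
    by (subst partial_deriv_sum) (simp_all add: partial_deriv_mult dD differentiable_mult sum_distrib_left algebra_simps)
  have pg1: "partial_deriv i (g1 i) x = euler w x * ?H i i x
     + (?D i x + (\<Sum>j\<in>UNIV. x $ j * ?H i j x)) * ?D i x
     - (1/2) * S x - x $ i * (\<Sum>j\<in>UNIV. ?D j x * ?H i j x)" for i x
    unfolding g1_def[abs_def]
    by (subst partial_deriv_add partial_deriv_cmult partial_deriv_mult,
        (intro differentiable_mult differentiable_const dE dD dS comp)+)+
       (simp add: pE pS partial_deriv_component algebra_simps)
  have pg2: "partial_deriv i (g2 i) x = (-c/2) * (x $ i * (2 * w x * ?D i x) + w x * w x)" for i x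
    unfolding g2_def[abs_def]
    by (subst partial_deriv_cmult partial_deriv_mult,
        (intro differentiable_mult differentiable_const dw comp)+)+
       (simp add: partial_deriv_component algebra_simps)
  have pG: "partial_deriv i (G i) x = norm x powr (2 - N) * partial_deriv i (g1 i) x
      + (2 - N) * norm x powr (2 - N - 2) * x $ i * g1 i x
      + norm x powr (- N) * partial_deriv i (g2 i) x + (- N) * norm x powr (- N - 2) * x $ i * g2 i x" for i x
    unfolding G_def[abs_def]
    by (simp add: partial_deriv_add weight_deriv Ck0_differentiable[OF g1] Ck0_differentiable[OF g2]
        Ck0_annular[OF g1] Ck0_annular[OF g2])
  have "norm x powr (- N) * (euler w x * ((norm x)\<^sup>2 * lap w x - (N - 2) * euler w x - c * w x))
     = (\<Sum>i\<in>UNIV. partial_deriv i (G i) x)" for x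
  proof (cases "x = 0")
    case True
    then show ?thesis by (simp add: pG)
  next
    case False
    let ?P = "norm x powr (- N - 2)"
    define T where "T = (\<Sum>i\<in>UNIV. x $ i * (\<Sum>j\<in>UNIV. ?D j x * ?H i j x))"
    \<comment> \<open>The two Hessian sums in the divergence of \<open>g1\<close> agree once mixed
      derivatives are exchanged; this is where Schwarz's theorem enters.\<close>
    have T: "(\<Sum>i\<in>UNIV. (\<Sum>j\<in>UNIV. x $ j * ?H i j x) * ?D i x) = T"
    proof -
      have "(\<Sum>i\<in>UNIV. (\<Sum>j\<in>UNIV. x $ j * ?H i j x) * ?D i x)
        = (\<Sum>i\<in>UNIV. \<Sum>j\<in>UNIV. x $ j * (?D i x * ?H j i x))"
        unfolding sum_distrib_right using partial_deriv_commute[of w] w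
        by (intro sum.cong refl) (simp add: Ck0_def)
      also have "\<dots> = T" unfolding T_def sum_distrib_left by (rule sum.swap)
      finally show ?thesis .
    qed
    have e: "norm x powr (- N) = ?P * (norm x)\<^sup>2" "norm x powr (2 - N - 2) = ?P * (norm x)\<^sup>2"
      "norm x powr (2 - N) = ?P * (norm x)\<^sup>2 * (norm x)\<^sup>2"
      by (simp_all add: norm_powr_Suc2[OF False, of "-N" "-N-2"] norm_powr_Suc2[OF False, of "2-N" "-N"])
    have s1: "(\<Sum>i\<in>UNIV. partial_deriv i (g1 i) x) = euler w x * lap w x + S x + T - N / 2 * S x - T"
    proof -
      have "(\<Sum>i\<in>UNIV. partial_deriv i (g1 i) x) = euler w x * lap w x + S x
        + (\<Sum>i\<in>UNIV. (\<Sum>j\<in>UNIV. x $ j * ?H i j x) * ?D i x) - N / 2 * S x - T"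
        unfolding pg1 lap_def S_def T_def N_def
        by (simp add: sum.distrib sum_subtractf sum_distrib_left[of "euler w x"] distrib_right)
      then show ?thesis unfolding T .
    qed
    have s2: "(\<Sum>i\<in>UNIV. x $ i * g1 i x) = euler w x * euler w x - (norm x)\<^sup>2 / 2 * S x"
    proof -
      have "x $ i * g1 i x = euler w x * (x $ i * ?D i x) - (x $ i * x $ i) * (S x / 2)" for i
        by (simp add: g1_def algebra_simps)
      then show ?thesis
        by (simp only: sum_subtractf sum_component_squares euler_def flip: sum_distrib_left sum_distrib_right)
    qed
    have s3: "(\<Sum>i\<in>UNIV. partial_deriv i (g2 i) x) = (-c/2) * (2 * w x * euler w x + N * (w x * w x))"
    proof -
      have "partial_deriv i (g2 i) x = (-c/2) * (2 * w x) * (x $ i * ?D i x) + (-c/2) * (w x * w x)" for i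
        unfolding pg2 by (simp add: algebra_simps)
      then have "(\<Sum>i\<in>UNIV. partial_deriv i (g2 i) x)
          = (-c/2) * (2 * w x) * euler w x + (\<Sum>i\<in>(UNIV::'n set). (-c/2) * (w x * w x))"
        by (simp only: sum.distrib euler_def flip: sum_distrib_left)
      also have "\<dots> = (-c/2) * (2 * w x * euler w x + N * (w x * w x))"
        by (simp add: N_def algebra_simps)
      finally show ?thesis .
    qed
    have s4: "(\<Sum>i\<in>UNIV. x $ i * g2 i x) = (norm x)\<^sup>2 * ((-c/2) * (w x * w x))"
      unfolding g2_def sum_component_squares[symmetric] sum_distrib_right
      by (simp add: mult_ac)
    have "(\<Sum>i\<in>UNIV. partial_deriv i (G i) x) = ?P * (norm x)\<^sup>2 * (norm x)\<^sup>2 * (\<Sum>i\<in>UNIV. partial_deriv i (g1 i) x)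
       + (2 - N) * (?P * (norm x)\<^sup>2) * (\<Sum>i\<in>UNIV. x $ i * g1 i x)
       + ?P * (norm x)\<^sup>2 * (\<Sum>i\<in>UNIV. partial_deriv i (g2 i) x)
       + (- N) * ?P * (\<Sum>i\<in>UNIV. x $ i * g2 i x)"
      unfolding pG e by (simp add: sum.distrib sum_subtractf sum_negf sum_distrib_left mult.assoc)
    also have "\<dots> = ?P * (norm x)\<^sup>2 * (euler w x * ((norm x)\<^sup>2 * lap w x - (N - 2) * euler w x - c * w x))"
      unfolding s1 s2 s3 s4 by (simp add: field_simps)
    finally show ?thesis unfolding e by simp
  qed
  then show ?thesis using integral_divergence[OF G] by simp
qed

text \<open>The hypothesis on \<open>s\<close> says that the weight, times the square of the power
  extracted by \<open>wdiv_weight\<close>, is the dilation invariant density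
  \<open>norm x powr (- N)\<close>.\<close>

lemma weighted_wdiv_square:
  fixes w :: "real^'n::finite \<Rightarrow> real"
  assumes w: "Ck0 (Suc (Suc 0)) w" and s: "- \<beta> + 2 * (\<alpha> + s - 2) = - real CARD('n)"
  shows "norm x powr (- \<beta>) * \<bar>wdiv \<alpha> (\<lambda>x. norm x powr s * w x) x\<bar>\<^sup>2 = norm x powr (- real CARD('n)) *
    ((norm x)\<^sup>2 * lap w x + (\<alpha> + 2 * s) * euler w x + s * (\<alpha> + s - 2 + CARD('n)) * w x)\<^sup>2"
proof -
  have "(norm x powr (\<alpha> + s - 2))\<^sup>2 = norm x powr (2 * (\<alpha> + s - 2))"
    by (simp only: power2_eq_square mult_2 powr_add)
  then have "norm x powr (- \<beta>) * (norm x powr (\<alpha> + s - 2))\<^sup>2 = norm x powr (- real CARD('n))"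
    unfolding s[symmetric] by (simp only: powr_add)
  then show ?thesis unfolding wdiv_weight[OF w] by (simp add: power_mult_distrib flip: mult.assoc)
qed

lemma integral_wdiv_transform:
  fixes \<phi> :: "real^'n::finite \<Rightarrow> real"
  assumes \<phi>: "Ck0 (Suc (Suc 0)) \<phi>"
    and \<eta>: "\<eta> = 2 + \<beta> - \<alpha>" and \<beta>': "\<beta>' = 2 * \<alpha> - \<beta> - 4"
  shows "(LINT x|lebesgue. norm x powr (- \<beta>) * \<bar>wdiv \<alpha> \<phi> x\<bar>\<^sup>2)
    = (LINT x|lebesgue. norm x powr (- \<beta>') * \<bar>wdiv \<alpha> (\<lambda>x. norm x powr (- \<eta>) * \<phi> x) x\<bar>\<^sup>2)"
proof -
  define N where "N = real CARD('n)"
  define A where "A = N + 2 * \<alpha> - \<beta> - 4"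
  define B where "B = N + \<beta>"
  \<comment> \<open>With this normalisation \<open>\<phi>\<close> carries the exponent
    \<open>- A/2\<close> and its transform \<open>- A/2 - \<eta> = - B/2\<close>. Each exponent
    satisfies the hypothesis of \<open>weighted_wdiv_square\<close> for its own weight.\<close>
  define w where "w x = norm x powr (A / 2) * \<phi> x" for x
  define P where "P x = (norm x)\<^sup>2 * lap w x - (N - 2) * euler w x - (A * B / 4) * w x" for x
  have w: "Ck0 (Suc (Suc 0)) w" unfolding w_def[abs_def] by (rule Ck0_weight[OF \<phi>])
  \<comment> \<open>At the origin \<open>powr\<close> yields 0, so \<open>\<phi>\<close> can be
    recovered from \<open>w\<close> at every point only because it vanishes there.\<close>
  have \<phi>0: "\<phi> 0 = 0" using annularD[OF Ck0_annular[OF \<phi>]] by (metis norm_zero)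
  have \<phi>_w: "\<phi> = (\<lambda>x. norm x powr (- (A / 2)) * w x)"
  proof
    show "\<phi> x = norm x powr (- (A / 2)) * w x" for x
      using \<phi>0 by (cases "x = 0") (simp_all add: w_def powr_minus field_simps)
  qed
  have v_w: "(\<lambda>x. norm x powr (- \<eta>) * \<phi> x) = (\<lambda>x. norm x powr (- (B / 2)) * w x)"
  proof -
    have "- \<eta> = - (B / 2) + A / 2" by (simp add: \<eta> A_def B_def field_simps)
    then show ?thesis by (simp only: w_def powr_add mult_ac)
  qed
  have 1: "norm x powr (- \<beta>) * \<bar>wdiv \<alpha> \<phi> x\<bar>\<^sup>2 = norm x powr (- N) * (P x + \<eta> * euler w x)\<^sup>2" for x
  proof -
    have "norm x powr (- \<beta>) * \<bar>wdiv \<alpha> \<phi> x\<bar>\<^sup>2 = norm x powr (- N) *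
      ((norm x)\<^sup>2 * lap w x + (\<alpha> + 2 * (- (A / 2))) * euler w x + (- (A / 2)) * (\<alpha> + (- (A / 2)) - 2 + N) * w x)\<^sup>2"
      unfolding N_def
    proof (subst \<phi>_w, rule weighted_wdiv_square[OF w])
      show "- \<beta> + 2 * (\<alpha> + - (A / 2) - 2) = - real CARD('n)"
        using A_def N_def by algebra
    qed
    also have "\<alpha> + 2 * (- (A / 2)) = \<eta> - (N - 2)" using \<eta> A_def by algebra
    also have "(- (A / 2)) * (\<alpha> + (- (A / 2)) - 2 + N) = - (A * B / 4)" by (simp add: A_def B_def field_simps)
    finally show ?thesis by (simp add: P_def algebra_simps)
  qed
  have 2: "norm x powr (- \<beta>') * \<bar>wdiv \<alpha> (\<lambda>x. norm x powr (- \<eta>) * \<phi> x) x\<bar>\<^sup>2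
      = norm x powr (- N) * (P x - \<eta> * euler w x)\<^sup>2" for x
  proof -
    have "norm x powr (- \<beta>') * \<bar>wdiv \<alpha> (\<lambda>x. norm x powr (- \<eta>) * \<phi> x) x\<bar>\<^sup>2 = norm x powr (- N) *
      ((norm x)\<^sup>2 * lap w x + (\<alpha> + 2 * (- (B / 2))) * euler w x + (- (B / 2)) * (\<alpha> + (- (B / 2)) - 2 + N) * w x)\<^sup>2"
      unfolding N_def v_w by (rule weighted_wdiv_square[OF w]) (simp add: B_def N_def \<beta>' field_simps)
    also have "\<alpha> + 2 * (- (B / 2)) = - \<eta> - (N - 2)" using \<eta> B_def by algebra
    also have "(- (B / 2)) * (\<alpha> + (- (B / 2)) - 2 + N) = - (A * B / 4)" by (simp add: A_def B_def field_simps)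
    finally show ?thesis by (simp add: P_def algebra_simps)
  qed
  have int: "integrable lebesgue (\<lambda>x. norm x powr a * \<bar>wdiv \<alpha> f x\<bar>\<^sup>2)" if "Ck0 (Suc (Suc 0)) f"
    for f :: "real^'n \<Rightarrow> real" and a
    unfolding power2_abs unfolding power2_eq_square
    by (rule Ck0_integrable[of 0]) (intro Ck0_weight Ck0_mult Ck0_wdiv that)
  have "(LINT x|lebesgue. norm x powr (- \<beta>) * \<bar>wdiv \<alpha> \<phi> x\<bar>\<^sup>2)
    - (LINT x|lebesgue. norm x powr (- \<beta>') * \<bar>wdiv \<alpha> (\<lambda>x. norm x powr (- \<eta>) * \<phi> x) x\<bar>\<^sup>2)
    = (LINT x|lebesgue. norm x powr (- \<beta>) * \<bar>wdiv \<alpha> \<phi> x\<bar>\<^sup>2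
      - norm x powr (- \<beta>') * \<bar>wdiv \<alpha> (\<lambda>x. norm x powr (- \<eta>) * \<phi> x) x\<bar>\<^sup>2)"
    by (subst Bochner_Integration.integral_diff) (intro int Ck0_weight \<phi> refl)+
  \<comment> \<open>\<open>(P + \<eta> E)^2 - (P - \<eta> E)^2 = 4 \<eta> E P\<close>: only the
    cross term remains.\<close>
  also have "\<dots> = (LINT x|lebesgue. 4 * \<eta> * (norm x powr (- N) * (euler w x * P x)))"
    unfolding 1 2 by (rule arg_cong[where f="integral\<^sup>L lebesgue"]) (simp add: fun_eq_iff power2_eq_square algebra_simps)
  also have "\<dots> = 0"
    using integral_euler_identity[OF w, of "A * B / 4"] by (simp add: P_def N_def)
  finally show ?thesis by simp
qed

section \<open>Uniqueness of the weak operator\<close>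

text \<open>The family \<open>t\<^sup>-\<^sup>k exp(-1/t)\<close> is closed under differentiation up to linear combinations, which
  gives smoothness without a separate formula for the higher derivatives.\<close>

definition bump :: "nat \<Rightarrow> real \<Rightarrow> real" where
  "bump k t = (if 0 < t then inverse t ^ k * exp (- inverse t) else 0)"

text \<open>From the right, substitute \<open>y = 1/t\<close>: the exponential beats every power of
  \<open>y\<close>.\<close>

lemma tendsto_bump_0: "(bump k \<longlongrightarrow> 0) (at 0)"
proof (rule filterlim_split_at)
  have "eventually (\<lambda>t. 0 = bump k t) (at_left 0)"
    by (rule eventually_at_leftI[of "-1"]) (auto simp: bump_def)
  then show "(bump k \<longlongrightarrow> 0) (at_left 0)" by (rule Lim_transform_eventually[OF tendsto_const])
  have "((\<lambda>t. inverse t ^ k / exp (inverse t)) \<longlongrightarrow> 0) (at_right (0::real))"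
    by (rule filterlim_compose[OF tendsto_power_div_exp_0 filterlim_inverse_at_top_right])
  moreover have "eventually (\<lambda>t. inverse t ^ k / exp (inverse t) = bump k t) (at_right (0::real))"
    by (rule eventually_at_rightI[of _ 1]) (auto simp: bump_def exp_minus divide_inverse)
  ultimately show "(bump k \<longlongrightarrow> 0) (at_right 0)" by (rule Lim_transform_eventually)
qed

text \<open>The delicate point is \<open>t = 0\<close>: there the difference quotient of
  \<open>bump k\<close> is \<open>bump (Suc k)\<close>, whose limit is 0.\<close>

lemma DERIV_bump: "(bump k has_real_derivative (bump (k + 2) t - k * bump (k + 1) t)) (at t)"
proof (cases t "0::real" rule: linorder_cases)
  case less
  have "eventually (\<lambda>s. bump k s = 0) (nhds t)"
    using eventually_nhds_in_open[of "{..<0}" t] less by (auto simp: bump_def elim!: eventually_mono)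
  from DERIV_cong_ev[OF refl this refl, of 0] show ?thesis using less by (simp add: bump_def[of _ t])
next
  case equal
  have "eventually (\<lambda>h. bump (Suc k) h = (bump k (0 + h) - bump k 0) / h) (at 0)"
    unfolding eventually_at_filter by (rule always_eventually) (auto simp: bump_def divide_inverse)
  from Lim_transform_eventually[OF tendsto_bump_0 this] show ?thesis
    using equal by (simp add: DERIV_def bump_def)
next
  case greater
  have ev: "eventually (\<lambda>s. bump k s = inverse s ^ k * exp (- inverse s)) (nhds t)"
    using eventually_nhds_in_open[of "{0<..}" t] greater by (auto simp: bump_def elim!: eventually_mono)
  have D: "((\<lambda>s. inverse s ^ k * exp (- inverse s)) has_real_derivative
      (bump (k + 2) t - k * bump (k + 1) t)) (at t)"
  proof -
    have 1: "(inverse has_real_derivative - (inverse t ^ 2)) (at t)"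
      using DERIV_inverse[of t] greater by (simp add: numeral_2_eq_2)
    have 2: "((\<lambda>s. inverse s ^ k * exp (- inverse s)) has_real_derivative
      inverse t ^ k * (exp (- inverse t) * (- (- (inverse t ^ 2))))
      + real k * (- (inverse t ^ 2) * inverse t ^ (k - Suc 0)) * exp (- inverse t)) (at t)"
      by (intro DERIV_mult' DERIV_power 1 DERIV_fun_exp DERIV_minus)
    have 3: "real k * (- (y ^ 2) * y ^ (k - Suc 0)) = - (real k * y ^ (k + 1))" for y :: real
      by (cases k) (simp_all add: power2_eq_square)
    show ?thesis using 2[unfolded 3] greater
      by (simp add: bump_def power_add power2_eq_square algebra_simps)
  qed
  show ?thesis using DERIV_cong_ev[OF refl ev refl] D by simp
qed

section \<open>Smooth cutoffs for boxes\<close>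

lemma bump_bounds: "0 \<le> bump 0 t" "bump 0 t \<le> 1"
  by (auto simp: bump_def)

lemma has_derivative_bump_affine:
  fixes x :: "real^'n::finite"
  shows "((\<lambda>x. bump k (a * x $ i + b)) has_derivative
    (\<lambda>h. (bump (k + 2) (a * x $ i + b) - k * bump (k + 1) (a * x $ i + b)) * (a * h $ i))) (at x)"
proof (rule has_derivative_compose[where g="bump k" and f="\<lambda>x. a * x $ i + b" and f'="\<lambda>h. a * h $ i"])
  show "((\<lambda>x. a * x $ i + b) has_derivative (\<lambda>h. a * h $ i)) (at x)"
    using has_derivative_add[OF has_derivative_mult_right[OF has_derivative_component] has_derivative_const, of a i b x] by simp
  show "(bump k has_derivative (*) (bump (k + 2) (a * x $ i + b) - k * bump (k + 1) (a * x $ i + b))) (at (a * x $ i + b))"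
    using DERIV_bump by (simp add: has_field_derivative_def)
qed

lemma Ck_bump: "Ck m (\<lambda>x::real^'n::finite. bump k (a * x $ i + b))"
proof (induction m arbitrary: k)
  case 0
  have "(\<lambda>x::real^'n::finite. bump k (a * x $ i + b)) differentiable_on UNIV"
    using has_derivative_bump_affine by (fastforce simp: differentiable_on_def differentiable_def)
  then show ?case by (simp add: differentiable_imp_continuous_on)
next
  case (Suc m)
  show ?case
  proof (rule Ck_SucI)
    show "(\<lambda>x::real^'n::finite. bump k (a * x $ i + b)) differentiable at x" for x
      using has_derivative_bump_affine by (fastforce simp: differentiable_def)
    have "partial_deriv j (\<lambda>x::real^'n. bump k (a * x $ i + b))
       = (\<lambda>x. (if j = i then a else 0) * (bump (k + 2) (a * x $ i + b) + (- real k) * bump (k + 1) (a * x $ i + b)))" for j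
      by (rule ext) (auto simp: partial_deriv_eqI[OF has_derivative_bump_affine] axis_def)
    then show "Ck m (partial_deriv j (\<lambda>x::real^'n. bump k (a * x $ i + b)))" for j
      by (simp only:) (intro Ck_mult Ck_add Ck_const Suc.IH)
  qed
qed

text \<open>For each coordinate, the product has one factor \<open>bump 0\<close> for each face,
  with argument the distance to that face scaled by \<open>n + 1\<close>. Outside the open box some
  factor is 0; inside, \<open>exp (- 1 / ((n + 1) t))\<close> tends to 1 for every
  \<open>t > 0\<close>. Scaling thus does the work of a mollifier, and the support never leaves the
  closed box.\<close>

lemma box_indicator_approx:
  fixes c d :: "real^'n::finite"
  assumes "0 \<notin> cbox c d"
  obtains \<psi> where "\<And>n. test_function (\<psi> n)" "\<And>n x. \<bar>\<psi> n x\<bar> \<le> indicator (cbox c d) x"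
    "\<And>x. (\<lambda>n. \<psi> n x) \<longlonglongrightarrow> indicator (box c d) x"
proof
  define \<psi> where "\<psi> n x = (\<Prod>i\<in>UNIV. bump 0 (real (Suc n) * x $ i + (- real (Suc n) * c $ i)) *
    bump 0 ((- real (Suc n)) * x $ i + real (Suc n) * d $ i))" for n and x :: "real^'n"
  have out: "\<psi> n x = 0" if x: "x \<notin> box c d" for n x
  proof -
    obtain i where "\<not> (c $ i < x $ i \<and> x $ i < d $ i)" using x unfolding mem_box_cart by blast
    then have "real (Suc n) * x $ i \<le> real (Suc n) * c $ i \<or> real (Suc n) * d $ i \<le> real (Suc n) * x $ i"
      by (metis mult_left_mono not_less of_nat_0_le_iff)
    then have "bump 0 (real (Suc n) * x $ i + (- real (Suc n) * c $ i)) *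
        bump 0 ((- real (Suc n)) * x $ i + real (Suc n) * d $ i) = 0"
      by (auto simp: bump_def algebra_simps)
    then show ?thesis unfolding \<psi>_def by (intro prod_zero) auto
  qed
  have le: "\<psi> n x \<le> 1" "0 \<le> \<psi> n x" for n x
    unfolding \<psi>_def by (intro prod_le_1 prod_nonneg conjI mult_nonneg_nonneg mult_le_one bump_bounds)+
  show "\<bar>\<psi> n x\<bar> \<le> indicator (cbox c d) x" for n x
    using le[of n x] out[of x n] box_subset_cbox[of c d] by (auto simp: indicator_def)
  show "(\<lambda>n. \<psi> n x) \<longlonglongrightarrow> indicator (box c d) x" for x
  proof (cases "x \<in> box c d")
    case True
    have 1: "(\<lambda>n. bump 0 (real (Suc n) * t)) \<longlonglongrightarrow> 1" if "t > 0" for t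
    proof -
      have "(\<lambda>n. exp (- (inverse t * inverse (real (Suc n))))) \<longlonglongrightarrow> exp (- (inverse t * 0))"
        by (intro tendsto_intros LIMSEQ_inverse_real_of_nat)
      then show ?thesis using that by (simp add: bump_def zero_less_mult_iff mult.commute)
    qed
    have "(\<lambda>n. \<Prod>i\<in>UNIV. bump 0 (real (Suc n) * (x $ i - c $ i)) * bump 0 (real (Suc n) * (d $ i - x $ i)))
       \<longlonglongrightarrow> (\<Prod>i\<in>(UNIV::'n set). 1 * 1)"
      using True by (intro tendsto_prod tendsto_mult 1) (auto simp: mem_box_cart)
    then show ?thesis using True by (simp add: \<psi>_def algebra_simps)
  qed (simp add: out)
  show "test_function (\<psi> n)" for n
  proof -
    have "open (- cbox c d)" by (simp add: open_Compl closed_cbox)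
    then obtain e where e: "e > 0" "ball 0 e \<subseteq> - cbox c d"
      using assms unfolding open_contains_ball by auto
    obtain R where R: "\<And>x. x \<in> cbox c d \<Longrightarrow> norm x \<le> R"
      using bounded_cbox[of c d] unfolding bounded_iff by auto
    have "annular (\<psi> n)" unfolding annular_def
    proof (rule exI[of _ e], rule conjI[OF \<open>e > 0\<close>], rule exI[of _ R], intro allI impI)
      fix x :: "real^'n" assume "norm x < e \<or> R < norm x"
      then have "x \<notin> cbox c d" using e(2) R by force
      then show "\<psi> n x = 0" using box_subset_cbox[of c d] by (intro out) auto
    qed
    moreover have "Ck k (\<psi> n)" for k
      unfolding \<psi>_def[abs_def] by (intro Ck_prod Ck_mult Ck_bump)
    ultimately show ?thesis by (simp add: test_function_Ck0 Ck0_def)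
  qed
qed

section \<open>The fundamental lemma of the calculus of variations\<close>

lemma loc_integrable_integral_box_0:
  assumes f: "loc_integrable f"
    and 0: "\<And>\<psi>. test_function \<psi> \<Longrightarrow> (LINT x|lebesgue. f x * \<psi> x) = 0"
    and cd: "0 \<notin> cbox c d"
  shows "(LINT x|lebesgue. indicator (box c d) x * f x) = 0"
proof -
  obtain \<psi> where \<psi>: "\<And>n. test_function (\<psi> n)" "\<And>n x. \<bar>\<psi> n x\<bar> \<le> indicator (cbox c d) x"
    "\<And>x. (\<lambda>n. \<psi> n x) \<longlonglongrightarrow> indicator (box c d) x"
    using box_indicator_approx[OF cd] by blast
  have int: "integrable lebesgue (\<lambda>x. indicator (cbox c d) x * f x)"
    using f cd compact_cbox unfolding loc_integrable_def set_integrable_def by fastforce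
  have \<psi>m: "\<psi> n \<in> borel_measurable lebesgue" for n
    using \<psi>(1)[of n] Ck0_integrable by (auto simp: test_function_Ck0)
  have eq: "\<psi> n x * (indicator (cbox c d) x * f x) = f x * \<psi> n x" for n x
    using \<psi>(2)[of n x] by (cases "x \<in> cbox c d") auto
  have "(\<lambda>n. LINT x|lebesgue. \<psi> n x * (indicator (cbox c d) x * f x)) \<longlonglongrightarrow>
     (LINT x|lebesgue. indicator (box c d) x * (indicator (cbox c d) x * f x))"
  proof (rule integral_dominated_convergence[where w="\<lambda>x. \<bar>indicator (cbox c d) x * f x\<bar>"])
    show "integrable lebesgue (\<lambda>x. \<bar>indicator (cbox c d) x * f x\<bar>)" using int by simp
    show "(\<lambda>x. indicat_real (box c d) x * (indicator (cbox c d) x * f x)) \<in> borel_measurable lebesgue"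
      by (rule borel_measurable_times[OF borel_measurable_indicator borel_measurable_integrable[OF int]]) simp
    show "(\<lambda>x. \<psi> n x * (indicator (cbox c d) x * f x)) \<in> borel_measurable lebesgue" for n
      by (rule borel_measurable_times[OF \<psi>m borel_measurable_integrable[OF int]])
    show "AE x in lebesgue. (\<lambda>n. \<psi> n x * (indicator (cbox c d) x * f x))
         \<longlonglongrightarrow> indicator (box c d) x * (indicator (cbox c d) x * f x)"
      by (intro AE_I2 tendsto_mult \<psi>(3) tendsto_const)
    show "AE x in lebesgue. norm (\<psi> n x * (indicator (cbox c d) x * f x)) \<le> \<bar>indicator (cbox c d) x * f x\<bar>" for n
    proof (rule AE_I2)
      fix x
      have "\<bar>\<psi> n x\<bar> \<le> 1" by (rule order_trans[OF \<psi>(2) indicator_le_1])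
      then show "norm (\<psi> n x * (indicator (cbox c d) x * f x)) \<le> \<bar>indicator (cbox c d) x * f x\<bar>"
        by (simp add: abs_mult mult_left_le_one_le)
    qed
  qed
  moreover have "indicator (box c d) x * (indicator (cbox c d) x * f x) = indicator (box c d) x * f x" for x
    using box_subset_cbox[of c d] by (auto simp: indicator_def)
  ultimately show ?thesis using 0[OF \<psi>(1)] by (simp add: eq LIMSEQ_const_iff)
qed

text \<open>Approximating indicators by test functions makes the integral of \<open>f\<close> vanish
  over every box whose closure misses the origin. Boxes are stable under intersection and generate
  the Borel sets, so inside such a box all integrals over Borel sets vanish and \<open>f\<close> is
  0 almost everywhere. Countably many closed boxes cover the punctured space.\<close>

lemma loc_integrable_AE_0:
  fixes f :: "real^'n::finite \<Rightarrow> real"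
  assumes f: "loc_integrable f"
    and 0: "\<And>\<psi>. test_function \<psi> \<Longrightarrow> (LINT x|lebesgue. f x * \<psi> x) = 0"
  shows "AE x in lebesgue. f x = 0"
proof -
  have box: "AE x in lebesgue. x \<in> cbox a b \<longrightarrow> f x = 0" if ab: "0 \<notin> cbox a b" for a b
  proof -
    let ?B = "box a b"
    have "integrable lebesgue (\<lambda>x. indicator (cbox a b) x * f x)"
      using f ab compact_cbox unfolding loc_integrable_def set_integrable_def by fastforce
    then have "integrable lebesgue (\<lambda>x. indicator ?B x *\<^sub>R (indicator (cbox a b) x * f x))"
      by (intro integrable_mult_indicator) auto
    moreover have "(\<lambda>x. indicator ?B x *\<^sub>R (indicator (cbox a b) x * f x)) = (\<lambda>x. indicator ?B x * f x)"
    proof (rule ext)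
      fix x show "indicator ?B x *\<^sub>R (indicator (cbox a b) x * f x) = indicator ?B x * f x"
        using box_subset_cbox[of a b] by (cases "x \<in> ?B") auto
    qed
    ultimately have int: "integrable lebesgue (\<lambda>x. indicator ?B x * f x)" by simp
    \<comment> \<open>Boxes generate only the Borel sets, so the restriction of \<open>f\<close> is
      replaced by a Borel function equal to it almost everywhere.\<close>
    obtain h where h: "h \<in> borel_measurable lborel" "AE x in lborel. indicator ?B x * f x = h x"
      using completion_ex_borel_measurable_real[of "\<lambda>x. indicator ?B x * f x" lborel] int by auto
    have hl: "AE x in lebesgue. indicator ?B x * f x = h x"
      by (rule AE_completion[OF h(2)])
    have hm: "h \<in> borel_measurable lebesgue" using h(1) by (rule measurable_completion)
    have hi: "integrable lebesgue h"
      using int hl hm integrable_cong_AE[of "\<lambda>x. indicator ?B x * f x" lebesgue h] by auto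
    then have hib: "integrable lborel h" using h(1) by (simp add: integrable_completion)
    have basic: "(LINT x:box c d|lborel. h x) = 0" for c d
    proof -
      have "(LINT x:box c d|lborel. h x) = (LINT x|lebesgue. indicator (box c d) x * h x)"
        unfolding set_lebesgue_integral_def using h(1)
        by (subst integral_completion) (auto simp: real_scaleR_def)
      also have "\<dots> = (LINT x|lebesgue. indicator (?B \<inter> box c d) x * f x)"
      proof -
        have eq: "(\<lambda>x. indicator (?B \<inter> box c d) x * f x) = (\<lambda>x. indicator (box c d) x * (indicator ?B x * f x))"
          by (simp add: fun_eq_iff indicator_inter_arith mult_ac)
        show ?thesis unfolding eq
        proof (rule integral_cong_AE)
          show "(\<lambda>x. indicat_real (box c d) x * h x) \<in> borel_measurable lebesgue"
            by (rule borel_measurable_times[OF borel_measurable_indicator hm]) simp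
          show "(\<lambda>x. indicat_real (box c d) x * (indicator ?B x * f x)) \<in> borel_measurable lebesgue"
            by (rule borel_measurable_times[OF borel_measurable_indicator borel_measurable_integrable[OF int]]) simp
        qed (use hl in eventually_elim, simp)
      qed
      \<comment> \<open>The intersection of the two boxes is again a box, and its closed version
        lies in \<open>cbox a b\<close>, so it misses the origin.\<close>
      also have "\<dots> = 0"
        unfolding box_Int_box using ab
        by (intro loc_integrable_integral_box_0[OF f 0]) (auto simp flip: Int_interval)
      finally show ?thesis .
    qed
    have all: "(LINT x:A|lborel. h x) = 0" if A: "A \<in> sets lborel" for A
    proof -
      have "Int_stable (range (\<lambda>(a, b). box a b :: (real^'n) set))"
        by (auto simp: Int_stable_def box_Int_box)
      moreover have "range (\<lambda>(a, b). box a b :: (real^'n) set) \<subseteq> Pow UNIV" by auto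
      moreover have "A \<in> sigma_sets UNIV (range (\<lambda>(a, b). box a b))"
        using A unfolding sets_lborel borel_eq_box by simp
      ultimately show ?thesis
      proof (induction rule: sigma_sets_induct_disjoint)
        case (basic A)
        then show ?case using \<open>\<And>c d. (LINT x:box c d|lborel. h x) = 0\<close> by auto
      next
        case empty
        show ?case by (simp add: set_lebesgue_integral_def)
      next
        case (compl A)
        then have A: "A \<in> sets lborel" unfolding sets_lborel borel_eq_box by simp
        have si: "set_integrable lborel X h" if "X \<in> sets lborel" for X
          unfolding set_integrable_def by (rule integrable_mult_indicator[OF that hib])
        have "(LINT x:UNIV|lborel. h x) = (LINT x:A|lborel. h x) + (LINT x:(UNIV - A)|lborel. h x)"
          using set_integral_Un[of A "UNIV - A" lborel h] A si by simp
        \<comment> \<open>\<open>h\<close> vanishes almost everywhere off \<open>?B\<close>, so the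
          integral over the whole space is again a box integral. This supplies the total mass that
          the complement step needs.\<close>
        moreover have "(LINT x:UNIV|lborel. h x) = (LINT x:?B|lborel. h x)"
          unfolding set_lebesgue_integral_def using h
          by (intro integral_cong_AE) (auto simp: indicator_def elim!: eventually_mono)
        ultimately show ?case using compl.IH basic[of a b] by simp
      next
        case (union A)
        then have A: "A i \<in> sets lborel" for i unfolding sets_lborel borel_eq_box by auto
        have "set_integrable lborel (\<Union>i. A i) h"
          unfolding set_integrable_def using A by (intro integrable_mult_indicator hib sets.countable_UN) auto
        then have "(LINT x:(\<Union>i. A i)|lborel. h x) = (\<Sum>i. (LINT x:(A i)|lborel. h x))"
          using union A by (intro lebesgue_integral_countable_add) (auto simp: disjoint_family_on_def)
        then show ?case using union by simp
      qed
    qed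
    have "AE x in lborel. h x = 0"
      using density_unique_real[OF hib, of "\<lambda>_. 0"] all by (simp add: set_lebesgue_integral_def)
    then have "AE x in lebesgue. h x = 0" by (rule AE_completion)
    moreover have "AE x in lebesgue. x \<notin> cbox a b - box a b"
      by (rule AE_not_in) (simp only: negligible_frontier_interval flip: negligible_iff_null_sets)
    ultimately show ?thesis using hl by eventually_elim (auto simp: indicator_def)
  qed
  obtain \<D> where \<D>: "countable \<D>" "\<D> \<subseteq> Pow (UNIV - {0})" "\<And>X. X \<in> \<D> \<Longrightarrow> \<exists>a b. X = cbox a b"
    "\<Union>\<D> = (UNIV - {0} :: (real^'n) set)"
    by (rule open_countable_Union_open_cbox[of "UNIV - {0::real^'n}"]) (auto simp: open_delete)
  have "AE x in lebesgue. \<forall>X\<in>\<D>. x \<in> X \<longrightarrow> f x = 0"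
  proof (rule AE_ball_countable[THEN iffD2, OF \<D>(1)], rule ballI)
    fix X assume X: "X \<in> \<D>"
    obtain a b where "X = cbox a b" using \<D>(3)[OF X] by blast
    with X \<D>(2) box[of a b] show "AE x in lebesgue. x \<in> X \<longrightarrow> f x = 0" by auto
  qed
  moreover have "AE x::real^'n in lebesgue. x \<notin> {0}"
    by (rule AE_not_in) (simp flip: negligible_iff_null_sets)
  ultimately show ?thesis
    by eventually_elim (use \<D>(4) in blast)
qed

text \<open>\<open>K\<close> is a shell containing the support of \<open>\<psi>\<close>, and
  \<open>C\<close> bounds \<open>\<psi>\<close>. Neither depends on \<open>g\<close>, so pairing
  with \<open>\<psi>\<close> is continuous for L1 convergence on compact sets away from the
  origin.\<close>

lemma Ck0_pairing:
  fixes \<psi> :: "real^'n::finite \<Rightarrow> real"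
  assumes \<psi>: "Ck0 k \<psi>"
  obtains K C where "compact K" "0 \<notin> K"
    "\<And>g. loc_integrable g \<Longrightarrow> integrable lebesgue (\<lambda>x. g x * \<psi> x)"
    "\<And>g. loc_integrable g \<Longrightarrow> \<bar>LINT x|lebesgue. g x * \<psi> x\<bar> \<le> C * (LINT x:K|lebesgue. \<bar>g x\<bar>)"
proof -
  obtain d R where dR: "d > 0" "\<And>x. norm x < d \<Longrightarrow> \<psi> x = 0" "\<And>x. R < norm x \<Longrightarrow> \<psi> x = 0"
    using annularD[OF Ck0_annular[OF \<psi>]] by metis
  define K where "K = cball (0::real^'n) R - ball 0 d"
  have K: "compact K" "0 \<notin> K" using dR(1) by (auto simp: K_def compact_diff)
  obtain C where C: "C > 0" "\<And>x. \<bar>\<psi> x\<bar> \<le> C" using Ck0_bounded[OF \<psi>] by metis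
  show ?thesis
  proof (rule that[OF K])
    fix g :: "real^'n \<Rightarrow> real"
    assume g: "loc_integrable g"
    have ig: "integrable lebesgue (\<lambda>x. indicator K x * g x)"
      using g K unfolding loc_integrable_def set_integrable_def by auto
    have eq: "g x * \<psi> x = (indicator K x * g x) * \<psi> x" for x
      using dR(2,3)[of x] by (cases "norm x < d"; cases "R < norm x") (auto simp: K_def indicator_def)
    have le: "norm (g x * \<psi> x) \<le> C * (indicator K x * \<bar>g x\<bar>)" for x
      unfolding eq using C by (simp add: abs_mult mult.commute[of C] mult_left_mono)
    show int: "integrable lebesgue (\<lambda>x. g x * \<psi> x)"
    proof (rule Bochner_Integration.integrable_bound[of _ "\<lambda>x. C * (indicator K x * g x)"])
      show "integrable lebesgue (\<lambda>x. C * (indicator K x * g x))" using ig by simp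
      show "(\<lambda>x. g x * \<psi> x) \<in> borel_measurable lebesgue"
        unfolding eq
        by (rule borel_measurable_times[OF borel_measurable_integrable[OF ig] borel_measurable_integrable[OF Ck0_integrable[OF \<psi>]]])
      show "AE x in lebesgue. norm (g x * \<psi> x) \<le> norm (C * (indicator K x * g x))"
        using le C(1) by (simp add: abs_mult)
    qed
    have "\<bar>LINT x|lebesgue. g x * \<psi> x\<bar> \<le> (LINT x|lebesgue. norm (g x * \<psi> x))"
      using integral_norm_bound[of lebesgue "\<lambda>x. g x * \<psi> x"] by simp
    also have "\<dots> \<le> (LINT x|lebesgue. C * (indicator K x * \<bar>g x\<bar>))"
    proof (rule integral_mono)
      have "integrable lebesgue (\<lambda>x. \<bar>indicator K x * g x\<bar>)" using ig by (rule integrable_abs)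
      then show "integrable lebesgue (\<lambda>x. C * (indicator K x * \<bar>g x\<bar>))" by (simp add: abs_mult)
    qed (use int le in auto)
    finally show "\<bar>LINT x|lebesgue. g x * \<psi> x\<bar> \<le> C * (LINT x:K|lebesgue. \<bar>g x\<bar>)"
      by (simp add: set_lebesgue_integral_def)
  qed
qed

lemma loc_integrable_diff:
  assumes "loc_integrable f" "loc_integrable g"
  shows "loc_integrable (\<lambda>x. f x - g x)"
  using assms unfolding loc_integrable_def by (auto intro: set_integral_diff)

text \<open>This lets the arbitrary choice in \<open>weak_wdiv\<close> be exchanged for any concrete
  representative inside an integral.\<close>

lemma has_weak_wdiv_unique:
  fixes u :: "real^'n::finite \<Rightarrow> real"
  assumes "has_weak_wdiv \<alpha> u f" "has_weak_wdiv \<alpha> u g"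
  shows "AE x in lebesgue. f x = g x"
proof -
  have li: "loc_integrable f" "loc_integrable g" using assms by (auto simp: has_weak_wdiv_def)
  then have "loc_integrable (\<lambda>x. f x - g x)" by (rule loc_integrable_diff)
  moreover have "(LINT x|lebesgue. (f x - g x) * \<psi> x) = 0" if \<psi>: "test_function \<psi>" for \<psi>
  proof -
    have "integrable lebesgue (\<lambda>x. g x * \<psi> x)" if "loc_integrable g" for g
      using \<psi> that Ck0_pairing unfolding test_function_Ck0 by metis
    from this[OF li(1)] this[OF li(2)] show ?thesis
      using assms \<psi> by (simp add: left_diff_distrib has_weak_wdiv_def)
  qed
  ultimately have "AE x in lebesgue. f x - g x = 0" by (rule loc_integrable_AE_0)
  then show ?thesis by simp
qed

section \<open>Completeness of square-integrable functions\<close>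

text \<open>Young's inequality in the role of the triangle inequality: the leading factor can be
  taken close to 1, and only squares occur, so it integrates directly even if the integrals are
  infinite.\<close>

lemma square_le_eps:
  fixes a b \<epsilon> :: real
  assumes "\<epsilon> > 0"
  shows "a\<^sup>2 \<le> (1 + \<epsilon>) * b\<^sup>2 + (1 + 1 / \<epsilon>) * (b - a)\<^sup>2"
proof -
  have "0 \<le> (\<epsilon> * b + (b - a))\<^sup>2 / \<epsilon>" using assms by simp
  also have "\<dots> = (1 + \<epsilon>) * b\<^sup>2 + (1 + 1 / \<epsilon>) * (b - a)\<^sup>2 - a\<^sup>2"
    using assms by (simp add: power2_eq_square field_simps)
  finally show ?thesis by simp
qed

lemma nn_integral_square_le:
  fixes f g :: "'a \<Rightarrow> real"
  assumes [measurable]: "f \<in> borel_measurable M" "g \<in> borel_measurable M" and \<epsilon>: "\<epsilon> > 0"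
  shows "(\<integral>\<^sup>+ x. ennreal ((f x)\<^sup>2) \<partial>M) \<le> ennreal (1 + \<epsilon>) * (\<integral>\<^sup>+ x. ennreal ((g x)\<^sup>2) \<partial>M)
    + ennreal (1 + 1 / \<epsilon>) * (\<integral>\<^sup>+ x. ennreal ((g x - f x)\<^sup>2) \<partial>M)"
proof -
  have "(\<integral>\<^sup>+ x. ennreal ((f x)\<^sup>2) \<partial>M) \<le>
    (\<integral>\<^sup>+ x. ennreal (1 + \<epsilon>) * ennreal ((g x)\<^sup>2) + ennreal (1 + 1 / \<epsilon>) * ennreal ((g x - f x)\<^sup>2) \<partial>M)"
    using square_le_eps[OF \<epsilon>] \<epsilon>
    by (intro nn_integral_mono) (simp flip: ennreal_mult ennreal_plus)
  then show ?thesis by (simp add: nn_integral_add nn_integral_cmult)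
qed

text \<open>The distance is a nonnegative integral, so the notion makes sense before
  \<open>F n\<close> or \<open>G\<close> is known to be square integrable.\<close>

definition L2_conv :: "'a measure \<Rightarrow> (nat \<Rightarrow> 'a \<Rightarrow> real) \<Rightarrow> ('a \<Rightarrow> real) \<Rightarrow> bool" where
  "L2_conv M F G \<longleftrightarrow> (\<forall>e>0. \<exists>K. \<forall>n\<ge>K. (\<integral>\<^sup>+ x. ennreal ((F n x - G x)\<^sup>2) \<partial>M) \<le> ennreal e)"

text \<open>Riesz-Fischer: a rapidly converging subsequence has a limit almost everywhere, and
  Fatou's lemma carries the Cauchy bound for the whole sequence over to that limit.\<close>

lemma L2_complete:
  fixes F :: "nat \<Rightarrow> 'a \<Rightarrow> real"
  assumes [measurable]: "\<And>n. F n \<in> borel_measurable M"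
    and cauchy: "\<And>e. e > 0 \<Longrightarrow> \<exists>K. \<forall>m\<ge>K. \<forall>n\<ge>K. (\<integral>\<^sup>+ x. ennreal ((F m x - F n x)\<^sup>2) \<partial>M) \<le> ennreal e"
  obtains G where "G \<in> borel_measurable M" "L2_conv M F G"
proof -
  have "\<exists>K. \<forall>m\<ge>K. \<forall>n\<ge>K. (\<integral>\<^sup>+ x. ennreal ((F m x - F n x)\<^sup>2) \<partial>M) \<le> ennreal ((1/4) ^ k)" for k :: nat
    by (rule cauchy) simp
  then obtain K where K: "\<And>k m n. K k \<le> m \<Longrightarrow> K k \<le> n \<Longrightarrow>
      (\<integral>\<^sup>+ x. ennreal ((F m x - F n x)\<^sup>2) \<partial>M) \<le> ennreal ((1/4) ^ k)" by metis
  \<comment> \<open>Along \<open>r\<close> the sum \<open>\<Sum>k. 2\<^sup>k d\<^sub>k\<^sup>2\<close> of the increments is integrable, and \<open>|d\<^sub>k| \<le> 2\<^sup>k d\<^sub>k\<^sup>2 + 2\<^sup>-\<^sup>k\<close>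
    then makes the increments summable almost everywhere.\<close>
  define r where "r k = k + (\<Sum>i\<le>k. K i)" for k
  \<comment> \<open>The sum makes \<open>r\<close> increasing and at least \<open>K k\<close>; the
    summand \<open>k\<close> sends it to infinity, so that in the Fatou step \<open>r k\<close>
    eventually passes \<open>K'\<close>.\<close>
  have r: "K k \<le> r k" "k \<le> r k" "r k \<le> r (Suc k)" for k
  proof -
    have "K k \<le> (\<Sum>i\<le>k. K i)" by (rule member_le_sum) auto
    then show "K k \<le> r k" by (simp add: r_def)
  qed (simp_all add: r_def)
  define d where "d k x = F (r (Suc k)) x - F (r k) x" for k x
  have [measurable]: "d k \<in> borel_measurable M" for k unfolding d_def[abs_def] by simp
  define G where "G x = lim (\<lambda>k. F (r k) x)" for x
  have [measurable]: "G \<in> borel_measurable M" unfolding G_def[abs_def] by simp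
  have "(\<integral>\<^sup>+ x. (\<Sum>k. ennreal (2 ^ k * (d k x)\<^sup>2)) \<partial>M) = (\<Sum>k. \<integral>\<^sup>+ x. ennreal (2 ^ k * (d k x)\<^sup>2) \<partial>M)"
    by (rule nn_integral_suminf) simp
  also have "\<dots> \<le> (\<Sum>k. ennreal ((1/2) ^ k))"
  proof (rule suminf_le)
    fix k
    have "(\<integral>\<^sup>+ x. ennreal (2 ^ k * (d k x)\<^sup>2) \<partial>M) = ennreal (2 ^ k) * (\<integral>\<^sup>+ x. ennreal ((d k x)\<^sup>2) \<partial>M)"
      by (simp add: ennreal_mult nn_integral_cmult)
    also have "\<dots> \<le> ennreal (2 ^ k) * ennreal ((1/4) ^ k)"
      unfolding d_def using r[of k] by (intro mult_left_mono K) auto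
    also have "\<dots> = ennreal ((1/2) ^ k)"
    proof -
      have "(2::real) ^ k * (1/4) ^ k = (1/2) ^ k" by (simp flip: power_mult_distrib)
      then show ?thesis by (simp flip: ennreal_mult)
    qed
    finally show "(\<integral>\<^sup>+ x. ennreal (2 ^ k * (d k x)\<^sup>2) \<partial>M) \<le> ennreal ((1/2) ^ k)" .
  qed auto
  also have "\<dots> = ennreal (\<Sum>k. (1/2) ^ k)"
    by (rule suminf_ennreal2) (auto intro: summable_geometric)
  also have "\<dots> < \<infinity>" by simp
  finally have "AE x in M. (\<Sum>k. ennreal (2 ^ k * (d k x)\<^sup>2)) \<noteq> \<infinity>"
    by (intro nn_integral_PInf_AE) auto
  then have lim: "AE x in M. (\<lambda>k. F (r k) x) \<longlonglongrightarrow> G x"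
  proof eventually_elim
    case (elim x)
    then have s: "summable (\<lambda>k. 2 ^ k * (d k x)\<^sup>2)"
      by (intro summable_suminf_not_top) auto
    have "summable (\<lambda>k. (1/2 :: real) ^ k)" by (rule summable_geometric) simp
    with s have s2: "summable (\<lambda>k. 2 ^ k * (d k x)\<^sup>2 + (1/2) ^ k)" by (rule summable_add)
    have le: "norm (d k x) \<le> 2 ^ k * (d k x)\<^sup>2 + (1/2) ^ k" for k
    proof -
      have "0 \<le> (2 ^ k * \<bar>d k x\<bar> - 1/2)\<^sup>2" by simp
      then have "2 ^ k * \<bar>d k x\<bar> \<le> 2 ^ k * (2 ^ k * (d k x)\<^sup>2) + 1"
        by (simp add: power2_diff power_mult_distrib power2_eq_square algebra_simps)
      then have "\<bar>d k x\<bar> \<le> (2 ^ k * (2 ^ k * (d k x)\<^sup>2) + 1) / 2 ^ k" by (simp add: field_simps)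
      then show ?thesis by (simp add: add_divide_distrib power_divide)
    qed
    have "summable (\<lambda>k. d k x)" by (rule summable_comparison_test'[OF s2]) (rule le)
    then have "convergent (\<lambda>n. \<Sum>k<n. d k x)" by (simp add: summable_iff_convergent)
    moreover have "(\<Sum>k<n. d k x) = F (r n) x - F (r 0) x" for n
      unfolding d_def by (rule sum_lessThan_telescope)
    ultimately have "convergent (\<lambda>n. F (r n) x - F (r 0) x)" by simp
    then have "convergent (\<lambda>n. F (r n) x)" by (simp add: convergent_diff_const_right_iff)
    then show ?case by (simp add: G_def convergent_LIMSEQ_iff)
  qed
  have "L2_conv M F G"
    unfolding L2_conv_def
  proof (intro allI impI)
    fix e :: real assume "e > 0"
    then obtain K' where K': "\<And>m n. m \<ge> K' \<Longrightarrow> n \<ge> K' \<Longrightarrow> (\<integral>\<^sup>+ x. ennreal ((F m x - F n x)\<^sup>2) \<partial>M) \<le> ennreal e"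
      using cauchy by meson
    show "\<exists>K. \<forall>n\<ge>K. (\<integral>\<^sup>+ x. ennreal ((F n x - G x)\<^sup>2) \<partial>M) \<le> ennreal e"
    proof (intro exI allI impI)
      fix n assume n: "n \<ge> K'"
      have "(\<integral>\<^sup>+ x. ennreal ((F n x - G x)\<^sup>2) \<partial>M) = (\<integral>\<^sup>+ x. liminf (\<lambda>k. ennreal ((F n x - F (r k) x)\<^sup>2)) \<partial>M)"
      proof (rule nn_integral_cong_AE, use lim in eventually_elim)
        case (elim x)
        have "(\<lambda>k. ennreal ((F n x - F (r k) x)\<^sup>2)) \<longlonglongrightarrow> ennreal ((F n x - G x)\<^sup>2)"
          by (intro tendsto_intros elim)
        then show ?case by (rule lim_imp_Liminf[OF sequentially_bot, symmetric])
      qed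
      also have "\<dots> \<le> liminf (\<lambda>k. \<integral>\<^sup>+ x. ennreal ((F n x - F (r k) x)\<^sup>2) \<partial>M)"
        by (rule nn_integral_liminf) simp
      also have "\<dots> \<le> ennreal e"
      proof -
        have "eventually (\<lambda>k. (\<integral>\<^sup>+ x. ennreal ((F n x - F (r k) x)\<^sup>2) \<partial>M) \<le> ennreal e) sequentially"
          using eventually_ge_at_top[of K'] by eventually_elim (use n r(2) le_trans in \<open>blast intro: K'\<close>)
        then have "liminf (\<lambda>k. \<integral>\<^sup>+ x. ennreal ((F n x - F (r k) x)\<^sup>2) \<partial>M) \<le> liminf (\<lambda>k::nat. ennreal e)"
          by (rule Liminf_mono)
        then show ?thesis by (simp add: Liminf_const)
      qed
      finally show "(\<integral>\<^sup>+ x. ennreal ((F n x - G x)\<^sup>2) \<partial>M) \<le> ennreal e" .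
    qed
  qed
  then show ?thesis by (intro that) simp_all
qed

lemma L2_conv_eventually:
  assumes "L2_conv M F G" "e > 0"
  shows "eventually (\<lambda>n. (\<integral>\<^sup>+ x. ennreal ((F n x - G x)\<^sup>2) \<partial>M) \<le> ennreal e) sequentially"
  using assms unfolding L2_conv_def eventually_sequentially by blast

text \<open>Compare \<open>G\<close> with \<open>F n\<close>, trade \<open>F n\<close> for
  \<open>F' n\<close> by \<open>eq\<close>, and compare \<open>F' n\<close> with \<open>G'\<close>.
  The hypotheses are symmetric in the two sequences, so a second use with exchanged roles gives
  equality of the limits.\<close>

lemma L2_conv_norm_le:
  assumes F: "L2_conv M F G" and F': "L2_conv M' F' G'"
    and [measurable]: "\<And>n. F n \<in> borel_measurable M" "G \<in> borel_measurable M"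
      "\<And>n. F' n \<in> borel_measurable M'" "G' \<in> borel_measurable M'"
    and eq: "\<And>n. (\<integral>\<^sup>+ x. ennreal ((F n x)\<^sup>2) \<partial>M) = (\<integral>\<^sup>+ x. ennreal ((F' n x)\<^sup>2) \<partial>M')"
  shows "(\<integral>\<^sup>+ x. ennreal ((G x)\<^sup>2) \<partial>M) \<le> (\<integral>\<^sup>+ x. ennreal ((G' x)\<^sup>2) \<partial>M')"
proof (rule ennreal_le_epsilon)
  fix e :: real
  assume "e > 0" and "(\<integral>\<^sup>+ x. ennreal ((G' x)\<^sup>2) \<partial>M') < top"
  then obtain I where I: "(\<integral>\<^sup>+ x. ennreal ((G' x)\<^sup>2) \<partial>M') = ennreal I" "I \<ge> 0"
    by (metis ennreal_cases less_irrefl)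
  \<comment> \<open>The total error will be at most \<open>3 \<epsilon> I + 3 e / 8\<close>, using
    \<open>\<epsilon> \<le> 1\<close>; the bound \<open>6 \<epsilon> I \<le> e\<close> makes the
    first part at most \<open>e / 2\<close>. The \<open>+ 1\<close> keeps the denominator
    positive.\<close>
  define \<epsilon> where "\<epsilon> = min 1 (e / (6 * (I + 1)))"
  have \<epsilon>: "\<epsilon> > 0" "\<epsilon> \<le> 1" and "\<epsilon> \<le> e / (6 * (I + 1))"
    using \<open>e > 0\<close> I(2) by (auto simp: \<epsilon>_def)
  then have "\<epsilon> * (6 * (I + 1)) \<le> e" using I(2) by (subst (asm) pos_le_divide_eq) auto
  then have \<epsilon>I: "6 * (\<epsilon> * I) \<le> e" using \<epsilon>(1) by (simp add: algebra_simps)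
  \<comment> \<open>Chosen to absorb the large factor \<open>1 + 1 / \<epsilon>\<close> of Young's
    inequality, leaving \<open>e / 8\<close>.\<close>
  define \<delta> where "\<delta> = e / (8 * (1 + 1 / \<epsilon>))"
  have \<delta>: "\<delta> > 0" "(1 + 1 / \<epsilon>) * \<delta> = e / 8"
  proof -
    have "1 + 1 / \<epsilon> > 0" using \<epsilon>(1) by (simp add: add_pos_pos)
    moreover have "t > 0 \<Longrightarrow> t * (e / (8 * t)) = e / 8" for t :: real by simp
    ultimately show "\<delta> > 0" "(1 + 1 / \<epsilon>) * \<delta> = e / 8"
      using \<open>e > 0\<close> unfolding \<delta>_def by (simp_all only: divide_pos_pos mult_pos_pos zero_less_numeral)
  qed
  obtain n where n: "(\<integral>\<^sup>+ x. ennreal ((F n x - G x)\<^sup>2) \<partial>M) \<le> ennreal \<delta>"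
    "(\<integral>\<^sup>+ x. ennreal ((F' n x - G' x)\<^sup>2) \<partial>M') \<le> ennreal \<delta>"
    using eventually_conj[OF L2_conv_eventually[OF F \<delta>(1)] L2_conv_eventually[OF F' \<delta>(1)]]
    by (auto simp: eventually_sequentially)
  have n': "(\<integral>\<^sup>+ x. ennreal ((G' x - F' n x)\<^sup>2) \<partial>M') \<le> ennreal \<delta>"
    using n(2) by (simp add: power2_commute)
  have "(\<integral>\<^sup>+ x. ennreal ((F' n x)\<^sup>2) \<partial>M') \<le> ennreal (1 + \<epsilon>) * ennreal I + ennreal (1 + 1 / \<epsilon>) * ennreal \<delta>"
    by (rule order_trans[OF nn_integral_square_le[of _ _ G', OF _ _ \<epsilon>(1)]])
      (auto simp: I intro!: add_mono mult_left_mono n')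
  also have "\<dots> = ennreal ((1 + \<epsilon>) * I + e / 8)"
    using \<epsilon>(1) I(2) \<delta> \<open>e > 0\<close> by (simp flip: ennreal_mult ennreal_plus)
  finally have 1: "(\<integral>\<^sup>+ x. ennreal ((F n x)\<^sup>2) \<partial>M) \<le> ennreal ((1 + \<epsilon>) * I + e / 8)" by (simp add: eq)
  have "(\<integral>\<^sup>+ x. ennreal ((G x)\<^sup>2) \<partial>M) \<le> ennreal (1 + \<epsilon>) * ennreal ((1 + \<epsilon>) * I + e / 8) + ennreal (1 + 1 / \<epsilon>) * ennreal \<delta>"
    by (rule order_trans[OF nn_integral_square_le[of _ _ "F n", OF _ _ \<epsilon>(1)]])
      (auto intro!: add_mono mult_left_mono n(1) 1)
  also have "\<dots> = ennreal ((1 + \<epsilon>) * ((1 + \<epsilon>) * I + e / 8) + e / 8)"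
    using \<epsilon>(1) I(2) \<delta> \<open>e > 0\<close> by (simp flip: ennreal_mult ennreal_plus)
  also have "\<dots> \<le> ennreal (I + e)"
  proof (rule ennreal_leI)
    have "\<epsilon> * e \<le> e" "\<epsilon> * (\<epsilon> * I) \<le> \<epsilon> * I" using \<epsilon> I(2) \<open>e > 0\<close> by (auto intro: mult_left_le_one_le)
    moreover have "(1 + \<epsilon>) * ((1 + \<epsilon>) * I + e / 8) + e / 8
        = I + 2 * (\<epsilon> * I) + \<epsilon> * (\<epsilon> * I) + e / 8 + (\<epsilon> * e) / 8 + e / 8"
      by (simp add: algebra_simps add_divide_distrib)
    ultimately show "(1 + \<epsilon>) * ((1 + \<epsilon>) * I + e / 8) + e / 8 \<le> I + e"
      using \<epsilon>I \<open>e > 0\<close> by linarith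
  qed
  finally show "(\<integral>\<^sup>+ x. ennreal ((G x)\<^sup>2) \<partial>M) \<le> (\<integral>\<^sup>+ x. ennreal ((G' x)\<^sup>2) \<partial>M') + ennreal e"
    using I(2) \<open>e > 0\<close> by (simp add: I(1) flip: ennreal_plus)
qed

section \<open>Passage to the completion\<close>

lemma weight_bounded_on_compact:
  fixes K :: "(real^'n::finite) set"
  assumes "compact K" "0 \<notin> K"
  obtains C where "C > 0" "\<And>x. x \<in> K \<Longrightarrow> norm x powr s \<le> C"
proof -
  have "continuous_on K (\<lambda>x. norm x powr s)"
    using assms(2) by (intro continuous_intros) auto
  then have "bounded ((\<lambda>x. norm x powr s) ` K)"
    using assms(1) by (intro compact_imp_bounded compact_continuous_image)
  then obtain C where C: "\<And>x. x \<in> K \<Longrightarrow> norm x powr s \<le> C"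
    unfolding bounded_iff by auto
  show ?thesis by (rule that[of "max C 1"]) (auto dest: C simp: le_max_iff_disj)
qed

lemma weight_measurable: "(\<lambda>x::real^'n::finite. norm x powr s) \<in> borel_measurable lebesgue"
  by (rule measurable_completion) simp

lemma AE_nonzero: "AE x::real^'n::finite in lebesgue. x \<noteq> 0"
proof -
  have "AE x::real^'n in lebesgue. x \<notin> {0}"
    by (rule AE_not_in) (simp flip: negligible_iff_null_sets)
  then show ?thesis by simp
qed

lemma loc_integrable_weight:
  fixes u :: "real^'n::finite \<Rightarrow> real"
  assumes "loc_integrable u"
  shows "loc_integrable (\<lambda>x. norm x powr s * u x)"
  unfolding loc_integrable_def
proof (intro allI impI)
  fix K :: "(real^'n) set" assume K: "compact K \<and> 0 \<notin> K"
  obtain C where C: "C > 0" "\<And>x. x \<in> K \<Longrightarrow> norm x powr s \<le> C"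
    using weight_bounded_on_compact K by metis
  have i: "integrable lebesgue (\<lambda>x. indicator K x *\<^sub>R u x)"
    using assms K unfolding loc_integrable_def set_integrable_def by blast
  have eq: "indicator K x *\<^sub>R (norm x powr s * u x) = norm x powr s * (indicator K x *\<^sub>R u x)" for x
    by simp
  show "(\<lambda>x. norm x powr s * u x) absolutely_integrable_on K"
    unfolding set_integrable_def
  proof (rule Bochner_Integration.integrable_bound)
    show "integrable lebesgue (\<lambda>x. C * (indicator K x *\<^sub>R u x))" using i by simp
    show "(\<lambda>x. indicator K x *\<^sub>R (norm x powr s * u x)) \<in> borel_measurable lebesgue"
      unfolding eq by (rule borel_measurable_times[OF weight_measurable borel_measurable_integrable[OF i]])
    show "AE x in lebesgue. norm (indicator K x *\<^sub>R (norm x powr s * u x)) \<le> norm (C * (indicator K x *\<^sub>R u x))"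
      using C by (auto simp: abs_mult indicator_def intro!: mult_right_mono)
  qed
qed

lemma loc_integrable_AE_cong:
  fixes u v :: "real^'n::finite \<Rightarrow> real"
  assumes u: "loc_integrable u" and eq: "AE x in lebesgue. u x = v x"
  shows "loc_integrable v"
proof -
  obtain S where S: "negligible S" "{x. \<not> u x = v x} \<subseteq> S"
    using eq unfolding eventually_ae_filter_negligible by blast
  show ?thesis
    unfolding loc_integrable_def
  proof (intro allI impI)
    fix K :: "(real^'n) set" assume "compact K \<and> 0 \<notin> K"
    then have "u absolutely_integrable_on K" using u unfolding loc_integrable_def by blast
    then show "v absolutely_integrable_on K"
      by (rule absolutely_integrable_spike[OF _ S(1)]) (metis (mono_tags, lifting) DiffD2 S(2) mem_Collect_eq subsetD)
  qed
qed

lemma Ck0_loc_integrable: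
  assumes "Ck0 k f" shows "loc_integrable f"
  unfolding loc_integrable_def set_integrable_def
  by (intro allI impI integrable_mult_indicator Ck0_integrable[OF assms])
    (auto intro: lmeasurable_compact fmeasurableD)

text \<open>Compact sets have finite measure, and \<open>|t| \<le> 1 + t^2\<close>.\<close>

lemma L2_loc_integrable:
  fixes G :: "real^'n::finite \<Rightarrow> real"
  assumes G: "G \<in> borel_measurable lebesgue" and fin: "(\<integral>\<^sup>+ x. ennreal ((G x)\<^sup>2) \<partial>lebesgue) < \<infinity>"
  shows "loc_integrable G"
  unfolding loc_integrable_def
proof (intro allI impI)
  fix K :: "(real^'n) set" assume K: "compact K \<and> 0 \<notin> K"
  then have Km: "K \<in> lmeasurable" by (intro lmeasurable_compact) simp
  have G2: "integrable lebesgue (\<lambda>x. (G x)\<^sup>2)"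
    using G fin by (intro integrableI_bounded) auto
  show "G absolutely_integrable_on K"
    unfolding set_integrable_def
  proof (rule Bochner_Integration.integrable_bound)
    show "integrable lebesgue (\<lambda>x. indicator K x + (G x)\<^sup>2)"
      using Km G2 by (intro Bochner_Integration.integrable_add integrable_real_indicator) (auto simp: fmeasurable_def)
    show "(\<lambda>x. indicator K x *\<^sub>R G x) \<in> borel_measurable lebesgue"
      using Km G by (intro borel_measurable_scaleR borel_measurable_indicator) auto
    have "\<bar>t\<bar> \<le> 1 + t\<^sup>2" for t :: real
    proof -
      have "0 \<le> (\<bar>t\<bar> - 1)\<^sup>2" by simp
      then have "2 * \<bar>t\<bar> \<le> 1 + t\<^sup>2" by (simp add: power2_diff)
      then show ?thesis by linarith
    qed
    then show "AE x in lebesgue. norm (indicator K x *\<^sub>R G x) \<le> norm (indicator K x + (G x)\<^sup>2)"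
      by (intro AE_I2) (auto simp: indicator_def)
  qed
qed

text \<open>In place of Cauchy-Schwarz, the product is bounded by
  \<open>\<epsilon> \<tau>^2 + (F n - G)^2 / \<epsilon>\<close>, with a fixed
  \<open>\<epsilon>\<close> and then a large \<open>n\<close>.\<close>

lemma L2_conv_pairing:
  fixes F :: "nat \<Rightarrow> real^'n::finite \<Rightarrow> real"
  assumes conv: "L2_conv lebesgue F G" and \<tau>: "Ck0 0 \<tau>"
    and F: "\<And>n. loc_integrable (F n)" and G: "loc_integrable G"
    and m: "\<And>n. F n \<in> borel_measurable lebesgue" "G \<in> borel_measurable lebesgue"
  shows "(\<lambda>n. LINT x|lebesgue. F n x * \<tau> x) \<longlonglongrightarrow> (LINT x|lebesgue. G x * \<tau> x)"
proof (rule LIMSEQ_I)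
  fix e :: real assume "e > 0"
  have int: "integrable lebesgue (\<lambda>x. g x * \<tau> x)" if "loc_integrable g" for g
    using Ck0_pairing[OF \<tau>] that by metis
  have \<tau>2: "integrable lebesgue (\<lambda>x. (\<tau> x)\<^sup>2)"
    unfolding power2_eq_square by (rule Ck0_integrable[OF Ck0_mult[OF \<tau> \<tau>]])
  define I where "I = (LINT x|lebesgue. (\<tau> x)\<^sup>2)"
  have I: "I \<ge> 0" unfolding I_def by (rule integral_nonneg_AE) simp
  \<comment> \<open>This keeps the \<open>\<tau>\<close> part below \<open>e / 2\<close>. The
    squared distance is then taken below \<open>\<epsilon> * (e / 2)\<close>, so dividing by
    \<open>\<epsilon>\<close> leaves another \<open>e / 2\<close>.\<close>
  define \<epsilon> where "\<epsilon> = e / (2 * (I + 1))"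
  have \<epsilon>: "\<epsilon> > 0" using \<open>e > 0\<close> I by (simp add: \<epsilon>_def)
  have \<epsilon>I: "\<epsilon> * I < e / 2" using \<open>e > 0\<close> I by (simp add: \<epsilon>_def field_simps)
  have "eventually (\<lambda>n. (\<integral>\<^sup>+ x. ennreal ((F n x - G x)\<^sup>2) \<partial>lebesgue) \<le> ennreal (\<epsilon> * (e / 2))) sequentially"
    using \<epsilon> \<open>e > 0\<close> by (intro L2_conv_eventually[OF conv]) simp
  then have "eventually (\<lambda>n. norm ((LINT x|lebesgue. F n x * \<tau> x) - (LINT x|lebesgue. G x * \<tau> x)) < e) sequentially"
  proof eventually_elim
    case (elim n)
    have D2: "integrable lebesgue (\<lambda>x. (F n x - G x)\<^sup>2)"
      using m elim by (intro integrableI_bounded) (auto intro: le_less_trans)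
    have D2e: "(LINT x|lebesgue. (F n x - G x)\<^sup>2) \<le> \<epsilon> * (e / 2)"
      using elim nn_integral_eq_integral[OF D2] \<epsilon> \<open>e > 0\<close> by (simp add: ennreal_le_iff)
    have "(LINT x|lebesgue. F n x * \<tau> x) - (LINT x|lebesgue. G x * \<tau> x) = (LINT x|lebesgue. (F n x - G x) * \<tau> x)"
      by (simp add: left_diff_distrib int F G)
    also have "norm \<dots> \<le> (LINT x|lebesgue. norm ((F n x - G x) * \<tau> x))"
      by (rule integral_norm_bound)
    also have "\<dots> \<le> (LINT x|lebesgue. \<epsilon> * (\<tau> x)\<^sup>2 + (F n x - G x)\<^sup>2 / \<epsilon>)"
    proof (rule integral_mono)
      show "integrable lebesgue (\<lambda>x. norm ((F n x - G x) * \<tau> x))"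
        by (simp add: left_diff_distrib int F G)
      show "integrable lebesgue (\<lambda>x. \<epsilon> * (\<tau> x)\<^sup>2 + (F n x - G x)\<^sup>2 / \<epsilon>)"
        using \<tau>2 D2 by simp
      show "norm ((F n x - G x) * \<tau> x) \<le> \<epsilon> * (\<tau> x)\<^sup>2 + (F n x - G x)\<^sup>2 / \<epsilon>" for x
      proof -
        let ?a = "\<bar>F n x - G x\<bar>" and ?b = "\<bar>\<tau> x\<bar>"
        have "0 \<le> (\<epsilon> * ?b - ?a)\<^sup>2 / \<epsilon>" using \<epsilon> by simp
        also have "\<dots> = \<epsilon> * ?b\<^sup>2 + ?a\<^sup>2 / \<epsilon> - 2 * (?a * ?b)"
          using \<epsilon> by (simp only: power2_eq_square) (simp add: field_simps)
        finally have "2 * (?a * ?b) \<le> \<epsilon> * (\<tau> x)\<^sup>2 + (F n x - G x)\<^sup>2 / \<epsilon>" by simp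
        moreover have "0 \<le> ?a * ?b" by simp
        ultimately show ?thesis unfolding real_norm_def abs_mult by linarith
      qed
    qed
    also have "\<dots> = \<epsilon> * I + (LINT x|lebesgue. (F n x - G x)\<^sup>2) / \<epsilon>"
      using \<tau>2 D2 by (simp add: I_def)
    also have "\<dots> < e"
    proof -
      have "(LINT x|lebesgue. (F n x - G x)\<^sup>2) / \<epsilon> \<le> e / 2"
        using D2e \<epsilon> by (simp add: field_simps)
      with \<epsilon>I show ?thesis by linarith
    qed
    finally show ?case .
  qed
  then show "\<exists>n0. \<forall>n\<ge>n0. norm ((LINT x|lebesgue. F n x * \<tau> x) - (LINT x|lebesgue. G x * \<tau> x)) < e"
    by (simp add: eventually_sequentially)
qed

lemma loc_conv_pairing:
  fixes \<phi> :: "nat \<Rightarrow> real^'n::finite \<Rightarrow> real"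
  assumes conv: "\<And>K. compact K \<Longrightarrow> 0 \<notin> K \<Longrightarrow> (\<lambda>n. LINT x:K|lebesgue. \<bar>\<phi> n x - u x\<bar>) \<longlonglongrightarrow> 0"
    and \<phi>: "\<And>n. loc_integrable (\<phi> n)" and u: "loc_integrable u" and \<tau>: "Ck0 0 \<tau>"
  shows "(\<lambda>n. LINT x|lebesgue. \<phi> n x * \<tau> x) \<longlonglongrightarrow> (LINT x|lebesgue. u x * \<tau> x)"
proof -
  show ?thesis
  proof (rule Ck0_pairing[OF \<tau>])
    fix K :: "(real^'n) set" and C :: real
    assume KC: "compact K" "0 \<notin> K"
      "\<And>g. loc_integrable g \<Longrightarrow> integrable lebesgue (\<lambda>x. g x * \<tau> x)"
      "\<And>g. loc_integrable g \<Longrightarrow> \<bar>LINT x|lebesgue. g x * \<tau> x\<bar> \<le> C * (LINT x:K|lebesgue. \<bar>g x\<bar>)"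
    have d: "loc_integrable (\<lambda>x. \<phi> n x - u x)" for n
      by (rule loc_integrable_diff[OF \<phi> u])
    have eq: "(LINT x|lebesgue. (\<phi> n x - u x) * \<tau> x)
        = (LINT x|lebesgue. \<phi> n x * \<tau> x) - (LINT x|lebesgue. u x * \<tau> x)" for n
      using KC(3) \<phi> u by (simp add: left_diff_distrib)
    have "(\<lambda>n. C * (LINT x:K|lebesgue. \<bar>\<phi> n x - u x\<bar>)) \<longlonglongrightarrow> C * 0"
      by (intro tendsto_mult tendsto_const conv KC)
    then have "(\<lambda>n. LINT x|lebesgue. (\<phi> n x - u x) * \<tau> x) \<longlonglongrightarrow> 0"
      by (intro Lim_null_comparison[of "\<lambda>n. LINT x|lebesgue. (\<phi> n x - u x) * \<tau> x"
            "\<lambda>n. C * (LINT x:K|lebesgue. \<bar>\<phi> n x - u x\<bar>)"] always_eventually allI)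
        (simp_all add: KC(4) d)
    then show ?thesis unfolding eq by (simp add: LIM_zero_cancel)
  qed
qed

section \<open>Closedness of the weak operator\<close>

definition wnorm2 :: "real \<Rightarrow> real \<Rightarrow> (real^'n::finite \<Rightarrow> real) \<Rightarrow> real" where
  "wnorm2 \<alpha> \<beta> f = (LINT x|lebesgue. norm x powr (- \<beta>) * \<bar>wdiv \<alpha> f x\<bar>\<^sup>2)"

lemma weight_square: "(norm x powr (- (\<beta> / 2)) * y)\<^sup>2 = norm x powr (- \<beta>) * \<bar>y\<bar>\<^sup>2"
  by (simp add: power_mult_distrib power2_eq_square[of "_ powr _"] flip: powr_add)

lemma nn_integral_wdiv:
  assumes "Ck0 (Suc (Suc 0)) f"
  shows "(\<integral>\<^sup>+ x. ennreal ((norm x powr (- (\<beta> / 2)) * wdiv \<alpha> f x)\<^sup>2) \<partial>lebesgue) = ennreal (wnorm2 \<alpha> \<beta> f)"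
  unfolding weight_square wnorm2_def
proof (rule nn_integral_eq_integral)
  show "integrable lebesgue (\<lambda>x. norm x powr (- \<beta>) * \<bar>wdiv \<alpha> f x\<bar>\<^sup>2)"
    unfolding power2_abs unfolding power2_eq_square
    by (rule Ck0_integrable[of 0]) (intro Ck0_weight Ck0_mult Ck0_wdiv assms)
qed simp

text \<open>Both sides of \<open>wdiv_symmetric\<close> for \<open>\<phi> n\<close> and a test
  function \<open>\<psi>\<close> converge: the side with \<open>wdiv \<alpha> (\<phi> n)\<close>
  through the weighted L2 limit, the side with \<open>wdiv \<alpha> \<psi>\<close> through local L1
  convergence to \<open>u\<close>. The limiting equation is the weak identity.\<close>

lemma D22_limit:
  fixes u :: "real^'n::finite \<Rightarrow> real" and \<phi> :: "nat \<Rightarrow> real^'n \<Rightarrow> real"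
  assumes u: "loc_integrable u" and \<phi>: "\<And>n. test_function (\<phi> n)"
    and cauchy: "\<And>e. e > 0 \<Longrightarrow> \<exists>M. \<forall>m\<ge>M. \<forall>n\<ge>M. D22_norm \<alpha> \<beta> (\<lambda>x. \<phi> m x - \<phi> n x) < e"
    and conv: "\<And>K. compact K \<Longrightarrow> 0 \<notin> K \<Longrightarrow> (\<lambda>n. LINT x:K|lebesgue. \<bar>\<phi> n x - u x\<bar>) \<longlonglongrightarrow> 0"
  obtains f where "has_weak_wdiv \<alpha> u f" "f \<in> borel_measurable lebesgue"
    "L2_conv lebesgue (\<lambda>n x. norm x powr (- (\<beta> / 2)) * wdiv \<alpha> (\<phi> n) x) (\<lambda>x. norm x powr (- (\<beta> / 2)) * f x)"
proof -
  define F where "F n x = norm x powr (- (\<beta> / 2)) * wdiv \<alpha> (\<phi> n) x" for n x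
  have \<phi>k: "Ck0 k (\<phi> n)" for k n using \<phi> by (simp add: test_function_Ck0)
  have F0: "Ck0 0 (F n)" for n unfolding F_def[abs_def] by (intro Ck0_weight Ck0_wdiv \<phi>k)
  have Fm: "F n \<in> borel_measurable lebesgue" for n using Ck0_integrable[OF F0] by simp
  have FF: "(\<integral>\<^sup>+ x. ennreal ((F m x - F n x)\<^sup>2) \<partial>lebesgue) = ennreal (wnorm2 \<alpha> \<beta> (\<lambda>x. \<phi> m x - \<phi> n x))" for m n
  proof -
    have "F m x - F n x = norm x powr (- (\<beta> / 2)) * wdiv \<alpha> (\<lambda>x. \<phi> m x - \<phi> n x) x" for x
      by (simp add: F_def wdiv_diff[OF \<phi>k \<phi>k] right_diff_distrib)
    then show ?thesis by (simp add: nn_integral_wdiv[OF Ck0_diff[OF \<phi>k \<phi>k]])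
  qed
  obtain G where G: "G \<in> borel_measurable lebesgue" "L2_conv lebesgue F G"
  proof (rule L2_complete[OF Fm])
    fix e :: real assume "e > 0"
    then obtain M where M: "\<And>m n. m \<ge> M \<Longrightarrow> n \<ge> M \<Longrightarrow> D22_norm \<alpha> \<beta> (\<lambda>x. \<phi> m x - \<phi> n x) < sqrt e"
      using cauchy[of "sqrt e"] by auto
    have "(\<integral>\<^sup>+ x. ennreal ((F m x - F n x)\<^sup>2) \<partial>lebesgue) \<le> ennreal e" if "m \<ge> M" "n \<ge> M" for m n
      unfolding FF using M[OF that] by (intro ennreal_leI) (simp add: D22_norm_def wnorm2_def)
    then show "\<exists>K. \<forall>m\<ge>K. \<forall>n\<ge>K. (\<integral>\<^sup>+ x. ennreal ((F m x - F n x)\<^sup>2) \<partial>lebesgue) \<le> ennreal e" by blast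
  qed
  \<comment> \<open>This undoes the weight. At the origin the inverse powers do not cancel, hence
    the identity with \<open>G\<close> only almost everywhere.\<close>
  define f where "f x = norm x powr (\<beta> / 2) * G x" for x
  have fG: "AE x in lebesgue. norm x powr (- (\<beta> / 2)) * f x = G x"
    using AE_nonzero by eventually_elim (simp add: f_def powr_minus)
  have "L2_conv lebesgue F (\<lambda>x. norm x powr (- (\<beta> / 2)) * f x)"
  proof -
    have "(\<integral>\<^sup>+ x. ennreal ((F n x - norm x powr (- (\<beta> / 2)) * f x)\<^sup>2) \<partial>lebesgue) = (\<integral>\<^sup>+ x. ennreal ((F n x - G x)\<^sup>2) \<partial>lebesgue)" for n
      by (rule nn_integral_cong_AE, use fG in eventually_elim) simp
    then show ?thesis using G(2) by (simp add: L2_conv_def)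
  qed
  moreover have fm: "f \<in> borel_measurable lebesgue"
    unfolding f_def[abs_def] by (rule borel_measurable_times[OF weight_measurable G(1)])
  moreover have "has_weak_wdiv \<alpha> u f"
    unfolding has_weak_wdiv_def
  proof (intro conjI allI impI u)
    obtain n where n: "(\<integral>\<^sup>+ x. ennreal ((F n x - G x)\<^sup>2) \<partial>lebesgue) \<le> ennreal 1"
      using L2_conv_eventually[OF G(2), of 1] by (auto simp: eventually_sequentially)
    \<comment> \<open>A single \<open>F n\<close> within squared distance 1 of \<open>G\<close>,
      with \<open>\<epsilon> = 1\<close> in Young's inequality, shows that \<open>G\<close> is
      square integrable and therefore locally integrable.\<close>
    have "(\<integral>\<^sup>+ x. ennreal ((G x)\<^sup>2) \<partial>lebesgue) \<le> ennreal (1 + 1) * (\<integral>\<^sup>+ x. ennreal ((F n x)\<^sup>2) \<partial>lebesgue)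
      + ennreal (1 + 1 / 1) * (\<integral>\<^sup>+ x. ennreal ((F n x - G x)\<^sup>2) \<partial>lebesgue)"
      by (rule nn_integral_square_le[OF G(1) Fm]) simp
    also have "\<dots> < \<infinity>"
    proof -
      have "(\<integral>\<^sup>+ x. ennreal ((F n x)\<^sup>2) \<partial>lebesgue) < \<infinity>"
        unfolding F_def using nn_integral_wdiv[OF \<phi>k] by simp
      then show ?thesis using n by (auto simp: ennreal_mult_less_top intro: le_less_trans)
    qed
    finally have Gl: "loc_integrable G" by (rule L2_loc_integrable[OF G(1)])
    then show fl: "loc_integrable f" unfolding f_def[abs_def] by (rule loc_integrable_weight)
    fix \<psi> :: "real^'n \<Rightarrow> real" assume \<psi>: "test_function \<psi>"
    then have \<psi>k: "Ck0 k \<psi>" for k by (simp add: test_function_Ck0)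
    have "(\<lambda>n. LINT x|lebesgue. F n x * (norm x powr (\<beta> / 2) * \<psi> x)) \<longlonglongrightarrow> (LINT x|lebesgue. G x * (norm x powr (\<beta> / 2) * \<psi> x))"
      by (intro L2_conv_pairing[OF G(2)] Ck0_weight \<psi>k Ck0_loc_integrable[OF F0] Gl Fm G(1))
    also have "(\<lambda>n. LINT x|lebesgue. F n x * (norm x powr (\<beta> / 2) * \<psi> x)) = (\<lambda>n. LINT x|lebesgue. \<phi> n x * wdiv \<alpha> \<psi> x)"
    proof
      fix n
      \<comment> \<open>The weights with exponents \<open>\<beta> / 2\<close> and
        \<open>- (\<beta> / 2)\<close> cancel off the origin; at the origin both sides are 0 because
        of this.\<close>
      have "\<psi> 0 = 0" using annularD[OF Ck0_annular[OF \<psi>k]] by (metis norm_zero)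
      then have eq: "F n x * (norm x powr (\<beta> / 2) * \<psi> x) = wdiv \<alpha> (\<phi> n) x * \<psi> x" for x
        by (cases "x = 0") (simp_all add: F_def powr_minus)
      show "(LINT x|lebesgue. F n x * (norm x powr (\<beta> / 2) * \<psi> x)) = (LINT x|lebesgue. \<phi> n x * wdiv \<alpha> \<psi> x)"
        by (simp only: eq wdiv_symmetric[OF \<phi>k \<psi>k])
    qed
    finally have "(\<lambda>n. LINT x|lebesgue. \<phi> n x * wdiv \<alpha> \<psi> x) \<longlonglongrightarrow> (LINT x|lebesgue. f x * \<psi> x)"
      by (simp add: f_def mult_ac)
    moreover have "(\<lambda>n. LINT x|lebesgue. \<phi> n x * wdiv \<alpha> \<psi> x) \<longlonglongrightarrow> (LINT x|lebesgue. u x * wdiv \<alpha> \<psi> x)"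
      by (intro loc_conv_pairing conv Ck0_loc_integrable[OF \<phi>k] u Ck0_wdiv \<psi>k)
    ultimately show "(LINT x|lebesgue. f x * \<psi> x) = (LINT x|lebesgue. u x * wdiv \<alpha> \<psi> x)"
      by (rule LIMSEQ_unique)
  qed
  ultimately show ?thesis unfolding F_def[abs_def] by (intro that)
qed

text \<open>Existence of one \<open>f\<close> makes the choice in \<open>weak_wdiv\<close> a genuine
  weak operator; uniqueness then replaces it by \<open>f\<close> under the integral.\<close>

lemma nn_integral_weak_wdiv:
  assumes "has_weak_wdiv \<alpha> u f"
  shows "(\<integral>\<^sup>+ x. ennreal (norm x powr (- \<beta>) * \<bar>weak_wdiv \<alpha> u x\<bar>\<^sup>2) \<partial>lebesgue)
    = (\<integral>\<^sup>+ x. ennreal ((norm x powr (- (\<beta> / 2)) * f x)\<^sup>2) \<partial>lebesgue)"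
proof -
  have "has_weak_wdiv \<alpha> u (weak_wdiv \<alpha> u)"
    unfolding weak_wdiv_def by (rule someI[of "has_weak_wdiv \<alpha> u", OF assms])
  from has_weak_wdiv_unique[OF this assms] show ?thesis
    unfolding weight_square by (intro nn_integral_cong_AE) (auto elim!: eventually_mono)
qed

lemma wnorm2_transform:
  assumes "Ck0 (Suc (Suc 0)) \<phi>" "\<eta> = 2 + \<beta> - \<alpha>" "\<beta>' = 2 * \<alpha> - \<beta> - 4"
  shows "wnorm2 \<alpha> \<beta>' (\<lambda>x. norm x powr (- \<eta>) * \<phi> x) = wnorm2 \<alpha> \<beta> \<phi>"
  unfolding wnorm2_def using integral_wdiv_transform[OF assms] by simp

theorem lemma5p1:
  fixes N :: nat
    and \<alpha> \<beta> \<eta> \<xi> \<beta>' p q :: real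
    and u v :: "real^'n::finite \<Rightarrow> real"
  assumes "N = CARD('n)"
    and "N \<ge> 5"
    and "\<alpha> > 2 - real N"
    and "(real N - 4) / (real N - 2) * \<alpha> - 4 \<le> \<beta>"
    and "\<beta> \<le> \<alpha> - 2"
    and "\<eta> = 2 + \<beta> - \<alpha>"
    and "\<xi> = (real N + 2 * \<alpha> - \<beta> - 4)\<^sup>2 / (real N + \<beta>) - real N"
    and "p = 2 * (real N + \<xi>) / (real N + 2 * \<alpha> - \<beta> - 4)"
    and "\<beta>' = 2 * \<alpha> - \<beta> - 4"
    and "q = 2 * (real N + \<beta>') / (real N - 4 + 2 * \<alpha> - \<beta>')"
    and "u \<in> D22 \<alpha> \<beta>"
    and "AE x in lebesgue. u x = norm x powr \<eta> * v x"
  shows "(\<integral>\<^sup>+ x. ennreal (norm x powr \<xi> * \<bar>u x\<bar> powr p) \<partial>lebesgue)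
           = (\<integral>\<^sup>+ x. ennreal (norm x powr \<beta>' * \<bar>v x\<bar> powr q) \<partial>lebesgue)
       \<and> (\<exists>f. has_weak_wdiv \<alpha> u f) \<and> (\<exists>g. has_weak_wdiv \<alpha> v g)
       \<and> (\<integral>\<^sup>+ x. ennreal (norm x powr (- \<beta>) * \<bar>weak_wdiv \<alpha> u x\<bar>\<^sup>2) \<partial>lebesgue)
           = (\<integral>\<^sup>+ x. ennreal (norm x powr (- \<beta>') * \<bar>weak_wdiv \<alpha> v x\<bar>\<^sup>2) \<partial>lebesgue)"
proof -
  note \<eta> = assms(6) and \<beta>' = assms(9)
  define A where "A = real N + 2 * \<alpha> - \<beta> - 4"
  define B where "B = real N + \<beta>"
  \<comment> \<open>The lower bound for \<open>\<beta>\<close> increases strictly with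
    \<open>\<alpha>\<close> and equals \<open>- N\<close> at \<open>\<alpha> = 2 - N\<close>, so
    \<open>\<beta> > - N\<close>.\<close>
  have B: "B > 0"
  proof -
    have "(real N - 4) / (real N - 2) * (2 - real N) < (real N - 4) / (real N - 2) * \<alpha>"
      using assms(2,3) by (intro mult_strict_left_mono divide_pos_pos) auto
    moreover have "(real N - 4) / (real N - 2) * (2 - real N) = 4 - real N"
      using assms(2) by (simp add: field_simps)
    ultimately show ?thesis using assms(4) unfolding B_def by linarith
  qed
  \<comment> \<open>\<open>A - B = 2 * (\<alpha> - 2 - \<beta>)\<close> is nonnegative.\<close>
  have A: "A > 0" using B assms(5) unfolding A_def B_def by linarith
  have \<xi>: "\<xi> = A\<^sup>2 / B - real N" using assms(7) by (simp add: A_def B_def)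
  have p: "p = 2 * A / B" using assms(8) A B by (simp add: \<xi> power2_eq_square flip: A_def)
  have q: "q = p"
  proof -
    have "real N + \<beta>' = A" "real N - 4 + 2 * \<alpha> - \<beta>' = B" using \<beta>' by (auto simp: A_def B_def)
    then show ?thesis using assms(10) p by simp
  qed
  have expo: "\<xi> + \<eta> * p = \<beta>'"
  proof -
    have e: "B - A = 2 * \<eta>" "\<beta>' = A - real N" using \<eta> \<beta>' by (auto simp: A_def B_def)
    have "\<xi> + \<eta> * p = A * (A + 2 * \<eta>) / B - real N"
      by (simp add: \<xi> p power2_eq_square add_divide_distrib algebra_simps)
    also have "A + 2 * \<eta> = B" using e(1) by simp
    finally show ?thesis using B e(2) by simp
  qed
  have first: "(\<integral>\<^sup>+ x. ennreal (norm x powr \<xi> * \<bar>u x\<bar> powr p) \<partial>lebesgue)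
           = (\<integral>\<^sup>+ x. ennreal (norm x powr \<beta>' * \<bar>v x\<bar> powr q) \<partial>lebesgue)"
  proof (rule nn_integral_cong_AE, use assms(12) in eventually_elim)
    case (elim x)
    have "\<bar>u x\<bar> powr p = norm x powr (\<eta> * p) * \<bar>v x\<bar> powr p"
      by (simp add: elim abs_mult powr_mult powr_powr)
    then show ?case by (simp add: q powr_add flip: expo)
  qed
  have ul: "loc_integrable u" using assms(11) by (simp add: D22_def)
  from assms(11)[unfolded D22_def mem_Collect_eq, THEN conjunct2]
  obtain \<phi> :: "nat \<Rightarrow> real^'n \<Rightarrow> real" where
    D: "(\<forall>n. test_function (\<phi> n)) \<and>
     (\<forall>e>0. \<exists>M. \<forall>m\<ge>M. \<forall>n\<ge>M. D22_norm \<alpha> \<beta> (\<lambda>x. \<phi> m x - \<phi> n x) < e) \<and>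
     (\<forall>K. compact K \<and> 0 \<notin> K \<longrightarrow>
        (\<lambda>n. LINT x:K|lebesgue. \<bar>\<phi> n x - u x\<bar>) \<longlonglongrightarrow> 0)"
    by (rule exE)
  have \<phi>: "\<And>n. test_function (\<phi> n)"
    and cauchy: "\<And>e. e > 0 \<Longrightarrow> \<exists>M. \<forall>m\<ge>M. \<forall>n\<ge>M. D22_norm \<alpha> \<beta> (\<lambda>x. \<phi> m x - \<phi> n x) < e"
    and conv: "\<And>K. compact K \<Longrightarrow> 0 \<notin> K \<Longrightarrow> (\<lambda>n. LINT x:K|lebesgue. \<bar>\<phi> n x - u x\<bar>) \<longlonglongrightarrow> 0"
    using D by simp_all
  have \<phi>k: "Ck0 k (\<phi> n)" for k n using \<phi> by (simp add: test_function_Ck0)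
  define \<theta> where "\<theta> n x = norm x powr (- \<eta>) * \<phi> n x" for n x
  have \<theta>k: "Ck0 k (\<theta> n)" for k n unfolding \<theta>_def[abs_def] by (rule Ck0_weight[OF \<phi>k])
  have vu: "AE x in lebesgue. norm x powr (- \<eta>) * u x = v x"
    using assms(12) AE_nonzero by eventually_elim (simp add: powr_minus)
  have vl: "loc_integrable v"
    by (rule loc_integrable_AE_cong[OF loc_integrable_weight[OF ul] vu])
  have \<theta>: "test_function (\<theta> n)" for n by (simp add: test_function_Ck0 \<theta>k)
  have \<theta>_diff: "(\<lambda>x. \<theta> m x - \<theta> n x) = (\<lambda>x. norm x powr (- \<eta>) * (\<phi> m x - \<phi> n x))" for m n
    by (simp add: \<theta>_def right_diff_distrib)
  \<comment> \<open>Multiplication by the weight is linear, so the isometry for single functions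
    applies to differences and the two Cauchy conditions coincide.\<close>
  have \<theta>_cauchy: "\<exists>M. \<forall>m\<ge>M. \<forall>n\<ge>M. D22_norm \<alpha> \<beta>' (\<lambda>x. \<theta> m x - \<theta> n x) < e" if "e > 0" for e
    using cauchy[OF that] wnorm2_transform[OF Ck0_diff[OF \<phi>k \<phi>k] \<eta> \<beta>']
    unfolding \<theta>_diff D22_norm_def wnorm2_def by simp
  \<comment> \<open>\<open>K\<close> avoids the origin, so the weight is bounded on it and L1
    convergence survives the multiplication. The relation between \<open>u\<close> and
    \<open>v\<close> holds only almost everywhere, hence the comparison by
    \<open>integral_mono_AE\<close>.\<close>
  have \<theta>_conv: "(\<lambda>n. LINT x:K|lebesgue. \<bar>\<theta> n x - v x\<bar>) \<longlonglongrightarrow> 0" if K: "compact K" "0 \<notin> K" for K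
  proof -
    obtain C where C: "C > 0" "\<And>x. x \<in> K \<Longrightarrow> norm x powr (- \<eta>) \<le> C"
      using weight_bounded_on_compact[OF K] by metis
    have i: "(\<lambda>x. \<bar>f x - g x\<bar>) absolutely_integrable_on K" if "loc_integrable f" "loc_integrable g" for f g
    proof -
      have "(\<lambda>x. f x - g x) absolutely_integrable_on K"
        using loc_integrable_diff[OF that] K by (simp add: loc_integrable_def)
      then show ?thesis by (rule set_integrable_abs)
    qed
    have le: "(LINT x:K|lebesgue. \<bar>\<theta> n x - v x\<bar>) \<le> C * (LINT x:K|lebesgue. \<bar>\<phi> n x - u x\<bar>)" for n
    proof -
      have "(LINT x:K|lebesgue. \<bar>\<theta> n x - v x\<bar>) \<le> (LINT x:K|lebesgue. C * \<bar>\<phi> n x - u x\<bar>)"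
        unfolding set_lebesgue_integral_def
      proof (rule integral_mono_AE)
        show "integrable lebesgue (\<lambda>x. indicator K x *\<^sub>R \<bar>\<theta> n x - v x\<bar>)"
          using i[OF Ck0_loc_integrable[OF \<theta>k] vl] by (simp add: set_integrable_def)
        show "integrable lebesgue (\<lambda>x. indicator K x *\<^sub>R (C * \<bar>\<phi> n x - u x\<bar>))"
          using i[OF Ck0_loc_integrable[OF \<phi>k] ul, of n]
          by (simp add: set_integrable_def mult.left_commute[of _ C])
        show "AE x in lebesgue. indicator K x *\<^sub>R \<bar>\<theta> n x - v x\<bar> \<le> indicator K x *\<^sub>R (C * \<bar>\<phi> n x - u x\<bar>)"
          using vu
        proof eventually_elim
          case (elim x)
          have "\<theta> n x - v x = norm x powr (- \<eta>) * (\<phi> n x - u x)"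
            by (simp add: \<theta>_def right_diff_distrib flip: elim)
          then show ?case using C(2)[of x] by (auto simp: indicator_def abs_mult intro: mult_right_mono)
        qed
      qed
      then show ?thesis by simp
    qed
    show ?thesis
    proof (rule tendsto_sandwich[OF _ _ tendsto_const])
      show "\<forall>\<^sub>F n in sequentially. 0 \<le> (LINT x:K|lebesgue. \<bar>\<theta> n x - v x\<bar>)"
        by (simp add: set_lebesgue_integral_def)
      show "\<forall>\<^sub>F n in sequentially. (LINT x:K|lebesgue. \<bar>\<theta> n x - v x\<bar>)
          \<le> C * (LINT x:K|lebesgue. \<bar>\<phi> n x - u x\<bar>)"
        by (simp add: le)
      show "(\<lambda>n. C * (LINT x:K|lebesgue. \<bar>\<phi> n x - u x\<bar>)) \<longlonglongrightarrow> 0"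
        using tendsto_mult[OF tendsto_const[of C] conv[OF K]] by simp
    qed
  qed
  obtain f where f: "has_weak_wdiv \<alpha> u f" "f \<in> borel_measurable lebesgue"
    "L2_conv lebesgue (\<lambda>n x. norm x powr (- (\<beta> / 2)) * wdiv \<alpha> (\<phi> n) x) (\<lambda>x. norm x powr (- (\<beta> / 2)) * f x)"
    by (rule D22_limit[OF ul \<phi> cauchy conv])
  obtain g where g: "has_weak_wdiv \<alpha> v g" "g \<in> borel_measurable lebesgue"
    "L2_conv lebesgue (\<lambda>n x. norm x powr (- (\<beta>' / 2)) * wdiv \<alpha> (\<theta> n) x) (\<lambda>x. norm x powr (- (\<beta>' / 2)) * g x)"
    by (rule D22_limit[OF vl \<theta> \<theta>_cauchy \<theta>_conv])
  have eq: "(\<integral>\<^sup>+ x. ennreal ((norm x powr (- (\<beta> / 2)) * wdiv \<alpha> (\<phi> n) x)\<^sup>2) \<partial>lebesgue)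
     = (\<integral>\<^sup>+ x. ennreal ((norm x powr (- (\<beta>' / 2)) * wdiv \<alpha> (\<theta> n) x)\<^sup>2) \<partial>lebesgue)" for n
    unfolding nn_integral_wdiv[OF \<phi>k] nn_integral_wdiv[OF \<theta>k]
    using wnorm2_transform[OF \<phi>k \<eta> \<beta>', of n] by (simp add: \<theta>_def[abs_def])
  have m: "(\<lambda>x. norm x powr s * h x) \<in> borel_measurable lebesgue" if "h \<in> borel_measurable lebesgue"
    for h :: "real^'n \<Rightarrow> real" and s
    by (rule borel_measurable_times[OF weight_measurable that])
  have mw: "wdiv \<alpha> h \<in> borel_measurable lebesgue" if "Ck0 (Suc (Suc 0)) h" for h :: "real^'n \<Rightarrow> real"
    using Ck0_integrable[OF Ck0_wdiv[OF that]] by simp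
  have "(\<integral>\<^sup>+ x. ennreal ((norm x powr (- (\<beta> / 2)) * f x)\<^sup>2) \<partial>lebesgue)
     = (\<integral>\<^sup>+ x. ennreal ((norm x powr (- (\<beta>' / 2)) * g x)\<^sup>2) \<partial>lebesgue)"
    by (intro antisym L2_conv_norm_le[OF f(3) g(3)] L2_conv_norm_le[OF g(3) f(3)] m mw f(2) g(2) \<phi>k \<theta>k eq eq[symmetric])
  then show ?thesis
    using first f(1) g(1) nn_integral_weak_wdiv[OF f(1)] nn_integral_weak_wdiv[OF g(1)] by auto
qed

end
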